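(* Let $\Lambda$ be an AR language satisfying $(Rabc)$, with directive word $D$. Let $$K=|w_{\lambda_y}|+\max\left(|C_{\mu_y+1}|,|X_{\mu_y+1}|\right)+1,\qquad v=S_{\mu_y}^{\,\mu_y-\mu+1}M_{\mu_y}\in\Lambda ,$$ with the notation given in the context (it is known that $v$ is a primitive perfectly clustering word of $\Lambda$ and that no word of $\Lambda$ of length at least $K$ clusters for any order and permutation). If $D$ begins with $ab^{n_1}c^{n_2}a^{n_3}b$ for some integers $n_1,n_2,n_3\ge1$, then $v$ has maximal length among the clustering words of $\Lambda$, and the bound $K$ is optimal, i.e. $|v|=K-1$. In all other cases (still under $(Rabc)$), there is a gap between the length of $v$ and the bound $K$, i.e. $|v|<K-1$.
   Context: AR (Arnoux-Rauzy) languages. The alphabet is $\{a,b,c\}$. Given an infinite sequence of rules $(x_k)_{k\ge0}$, $x_k\in\{a,b,c\}$, in which each of $a,b,c$ occurs infinitely often, define words by $A_0=a$, $B_0=b$, $C_0=c$ and: by rule $(a)$ at stage $k$ (i.e. $x_k=a$), $A_{k+1}=A_k$, $B_{k+1}=B_kA_k$, $C_{k+1}=C_kA_k$; by rule $(b)$, $A_{k+1}=A_kB_k$, $B_{k+1}=B_k$, $C_{k+1}=C_kB_k$; by rule $(c)$, $A_{k+1}=A_kC_k$, $B_{k+1}=B_kC_k$, $C_{k+1}=C_k$. The AR language $\Lambda$ is the set of all factors of the words $A_k,B_k,C_k$, $k\ge0$; its directive word is $D=x_0x_1x_2\cdots$. The words $w_k$ are given by: $w_0$ is the empty word, and $w_{k+1}=w_kA_k$,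 $w_kB_k$ or $w_kC_k$ according to whether the rule at stage $k$ is $(a)$, $(b)$ or $(c)$. $(Rabc)$: the rule at stage $0$ is $(a)$ and the first rule different from $(a)$ is $(b)$. Notation under $(Rabc)$: $\lambda_1$ is the stage of the first rule $(b)$; $\lambda_2$ is the stage of the first rule $(c)$; $\lambda_a$ (resp. $\lambda_b$) is the stage of the last rule $(a)$ (resp. $(b)$) before $\lambda_2$; $\mu_a$ (resp. $\mu_b$) is the stage of the first rule $(a)$ (resp. $(b)$) after $\lambda_2$; $x,y$ are the elements of $\{a,b\}$ with $\mu_x<\mu_y$; $X_k=A_k$ if $x=a$ and $X_k=B_k$ if $x=b$. Let $(z)$ be the rule at stage $\mu_y-1$ (so $z=x$ or $z=c$); $\mu$ is the stage of the first rule in the maximal string of consecutive rules $(z)$ ending at stage $\mu_y-1$ (i.e. just before stage $\mu_y$). For $k>\lambda_1$ the words $A_k,B_k,C_k$ have three different lengths and are renamed $S_k,M_k,L_k$ so that $|S_k|<|M_k|<|L_k|$. Clustering. For a total order on the alphabet, written $a_1<\dots<a_r$, the Burrows-Wheeler transform $B(w)$ of a word $w=w_1\cdots w_n$ is obtained by listing its $n$ cyclic conjugates $w_i\cdots w_nw_1\cdots w_{i-1}$ (with multiplicity) in nondecreasing lexicographical order and reading the sequence of their last letters. The word $w$ clusters for this order and a permutation $\pi\neq \mathrm{Id}$ of the alphabet if $B(w)=(\pi a_1)^{n_{\pi a_1}}\cdots(\pi a_r)^{n_{\pi a_r}}$, where $n_a\ge0$ is the number of occurrences of $a$ in $w$.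 A word is clustering if it clusters for some order on $\{a,b,c\}$ and some permutation $\pi\ne\mathrm{Id}$; it is perfectly clustering if it clusters, for some order, for the symmetric permutation $\pi a_i=a_{r+1-i}$. *)

theory Defs
  imports "HOL-Library.Multiset" "HOL-Library.Sublist"
begin

section \<open>Arnoux-Rauzy languages\<close>

datatype letter = La | Lb | Lc

definition AR_directive :: "(nat \<Rightarrow> letter) \<Rightarrow> bool" where
  "AR_directive D \<longleftrightarrow> (\<forall>l. infinite {k. D k = l})"

text \<open>\<open>AR_word D k La\<close>, \<open>AR_word D k Lb\<close>, \<open>AR_word D k Lc\<close> are the words
  $A_k$, $B_k$, $C_k$: under the rule $D_k$, the word of that letter is kept, and it is
  appended on the right to the words of the two other letters.\<close>

primrec AR_word :: "(nat \<Rightarrow> letter) \<Rightarrow> nat \<Rightarrow> letter \<Rightarrow> letter list" where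
  "AR_word D 0 l = [l]"
| "AR_word D (Suc k) l =
    (if l = D k then AR_word D k l else AR_word D k l @ AR_word D k (D k))"

definition AR_language :: "(nat \<Rightarrow> letter) \<Rightarrow> letter list set" where
  "AR_language D = {u. \<exists>k l. sublist u (AR_word D k l)}"

primrec w_word :: "(nat \<Rightarrow> letter) \<Rightarrow> nat \<Rightarrow> letter list" where
  "w_word D 0 = []"
| "w_word D (Suc k) = w_word D k @ AR_word D k (D k)"

definition Rabc :: "(nat \<Rightarrow> letter) \<Rightarrow> bool" where
  "Rabc D \<longleftrightarrow> D 0 = La \<and> D (LEAST k. D k \<noteq> La) = Lb"

definition lambda2 :: "(nat \<Rightarrow> letter) \<Rightarrow> nat" where
  "lambda2 D = (LEAST k. D k = Lc)"

text \<open>\<open>last_before\<close> gives $\lambda_a, \lambda_b$ and \<open>first_after\<close> gives $\mu_a, \mu_b$;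
  both are meant for the letters \<open>La\<close> and \<open>Lb\<close> only.\<close>

definition last_before :: "(nat \<Rightarrow> letter) \<Rightarrow> letter \<Rightarrow> nat" where
  "last_before D l = (GREATEST k. k < lambda2 D \<and> D k = l)"

definition first_after :: "(nat \<Rightarrow> letter) \<Rightarrow> letter \<Rightarrow> nat" where
  "first_after D l = (LEAST k. k > lambda2 D \<and> D k = l)"

definition x_letter :: "(nat \<Rightarrow> letter) \<Rightarrow> letter" where
  "x_letter D = (if first_after D La < first_after D Lb then La else Lb)"

definition y_letter :: "(nat \<Rightarrow> letter) \<Rightarrow> letter" where
  "y_letter D = (if first_after D La < first_after D Lb then Lb else La)"

definition mu_y :: "(nat \<Rightarrow> letter) \<Rightarrow> nat" where
  "mu_y D = first_after D (y_letter D)"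

definition mu_string :: "(nat \<Rightarrow> letter) \<Rightarrow> nat" where
  "mu_string D = (LEAST j. j < mu_y D \<and> (\<forall>i. j \<le> i \<and> i < mu_y D \<longrightarrow> D i = D (mu_y D - 1)))"

text \<open>The list $[S_k, M_k, L_k]$; it is determined by the lengths alone only when these are
  distinct, i.e. after the stage of the first rule $(b)$.\<close>

definition words_by_length :: "(nat \<Rightarrow> letter) \<Rightarrow> nat \<Rightarrow> letter list list" where
  "words_by_length D k = sort_key length [AR_word D k La, AR_word D k Lb, AR_word D k Lc]"

definition S_word :: "(nat \<Rightarrow> letter) \<Rightarrow> nat \<Rightarrow> letter list" where
  "S_word D k = words_by_length D k ! 0"

definition M_word :: "(nat \<Rightarrow> letter) \<Rightarrow> nat \<Rightarrow> letter list" where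
  "M_word D k = words_by_length D k ! 1"

definition K_bound :: "(nat \<Rightarrow> letter) \<Rightarrow> nat" where
  "K_bound D = length (w_word D (last_before D (y_letter D)))
     + max (length (AR_word D (mu_y D + 1) Lc)) (length (AR_word D (mu_y D + 1) (x_letter D))) + 1"

definition v_word :: "(nat \<Rightarrow> letter) \<Rightarrow> letter list" where
  "v_word D = concat (replicate (mu_y D - mu_string D + 1) (S_word D (mu_y D))) @ M_word D (mu_y D)"

definition begins_with :: "(nat \<Rightarrow> letter) \<Rightarrow> letter list \<Rightarrow> bool" where
  "begins_with D p \<longleftrightarrow> map D [0..<length p] = p"


section \<open>Clustering words\<close>

text \<open>A total order $a_1 < \dots < a_r$ on a finite alphabet is given by the list
  $[a_1, \dots, a_r]$ of all its letters.\<close>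

definition letter_order :: "'a list \<Rightarrow> bool" where
  "letter_order as \<longleftrightarrow> distinct as \<and> set as = UNIV"

definition letter_less :: "'a list \<Rightarrow> ('a \<times> 'a) set" where
  "letter_less as = {(as ! i, as ! j) | i j. i < j \<and> j < length as}"

definition lex_le :: "'a list \<Rightarrow> 'a list \<Rightarrow> 'a list \<Rightarrow> bool" where
  "lex_le as u v \<longleftrightarrow> u = v \<or> (u, v) \<in> lexord (letter_less as)"

definition conjugates :: "'a list \<Rightarrow> 'a list list" where
  "conjugates w = map (\<lambda>i. rotate i w) [0..<length w]"

definition sorted_conjugates :: "'a list \<Rightarrow> 'a list \<Rightarrow> 'a list list" where
  "sorted_conjugates as w =
    (THE cs. mset cs = mset (conjugates w) \<and> sorted_wrt (lex_le as) cs)"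

lemma linorder_lex_le:
  assumes "letter_order as"
  shows "class.linorder (lex_le as) (\<lambda>u v. (u, v) \<in> lexord (letter_less as))"
proof -
  let ?r = "letter_less as"
  from assms have d: "distinct as" and s: "set as = UNIV"
    by (auto simp: letter_order_def)
  have irr: "(x, x) \<notin> ?r" for x
    using d by (auto simp: letter_less_def nth_eq_iff_index_eq)
  have tr: "trans ?r"
  proof (rule transI)
    fix x y z assume "(x, y) \<in> ?r" "(y, z) \<in> ?r"
    then obtain i j i' j' where "x = as ! i" "y = as ! j" "i < j" "j < length as"
      "y = as ! i'" "z = as ! j'" "i' < j'" "j' < length as"
      by (auto simp: letter_less_def)
    moreover from this have "j = i'"
      using d by (metis nth_eq_iff_index_eq less_trans)
    ultimately show "(x, z) \<in> ?r"
      unfolding letter_less_def by (auto intro: less_trans)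
  qed
  have tot: "(x, y) \<in> ?r \<or> x = y \<or> (y, x) \<in> ?r" for x y
  proof -
    obtain i j where "x = as ! i" "i < length as" "y = as ! j" "j < length as"
      using s by (metis UNIV_I in_set_conv_nth)
    then show ?thesis
      unfolding letter_less_def by (cases i j rule: linorder_cases) auto
  qed
  have lirr: "(u, u) \<notin> lexord ?r" for u
    by (rule lexord_irreflexive) (use irr in blast)
  have ltr: "(u, w) \<in> lexord ?r" if "(u, v) \<in> lexord ?r" "(v, w) \<in> lexord ?r" for u v w
    using lexord_trans that tr by blast
  have ltot: "(u, v) \<in> lexord ?r \<or> u = v \<or> (v, u) \<in> lexord ?r" for u v
    by (rule lexord_linear) (use tot in blast)
  show ?thesis
    by unfold_locales (use lirr ltr ltot in \<open>unfold lex_le_def, blast+\<close>)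
qed

lemma sorted_conjugates_ex1:
  assumes "letter_order as"
  shows "\<exists>!cs. mset cs = mset (conjugates w) \<and> sorted_wrt (lex_le as) cs"
proof -
  interpret lex: linorder "lex_le as" "\<lambda>u v. (u, v) \<in> lexord (letter_less as)"
    by (rule linorder_lex_le[OF assms])
  show ?thesis
    by (rule ex1I[of _ "lex.sort (conjugates w)"])
      (use lex.sorted_sort lex.mset_sort lex.properties_for_sort in auto)
qed

definition bwt :: "'a list \<Rightarrow> 'a list \<Rightarrow> 'a list" where
  "bwt as w = map last (sorted_conjugates as w)"

definition clusters_for :: "'a list \<Rightarrow> ('a \<Rightarrow> 'a) \<Rightarrow> 'a list \<Rightarrow> bool" where
  "clusters_for as \<pi> w \<longleftrightarrow>
    bwt as w = concat (map (\<lambda>a. replicate (count_list w (\<pi> a)) (\<pi> a)) as)"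

definition clustering :: "'a list \<Rightarrow> bool" where
  "clustering w \<longleftrightarrow> (\<exists>as \<pi>. letter_order as \<and> bij \<pi> \<and> \<pi> \<noteq> id \<and> clusters_for as \<pi> w)"

end

theory Submission
  imports Defs
begin

text \<open>
  The two halves of the statement have independent proofs.

  The gap in the general case is a computation with lengths. Up to the stage of the first rule
  \<open>(c)\<close> the words \<open>A\<close>, \<open>B\<close> and \<open>w\<close> form a binary system, where the length of \<open>w\<close> is determined
  by the lengths of \<open>A\<close> and \<open>B\<close> (\<open>binary_prefix_lengths\<close>); from that stage to \<open>\<mu>\<^sub>y\<close> only the
  rules \<open>(x)\<close> and \<open>(c)\<close> occur, and one linear relation between the three lengths persists
  (\<open>balanced_lengths\<close>). These relations turn the difference between \<open>K - 1\<close> and the length of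
  \<open>v\<close> into a quantity that is visibly nonnegative, and whose vanishing dictates the rules at
  all stages up to \<open>\<mu>\<^sub>y\<close> (\<open>v_length_gap\<close>).

  If \<open>D\<close> begins with \<open>a b\<^sup>n\<^sup>1 c\<^sup>n\<^sup>2 a\<^sup>n\<^sup>3 b\<close>, the words \<open>A\<close>, \<open>B\<close>, \<open>C\<close> at stage \<open>\<mu>\<^sub>y\<close> are
  explicit, and \<open>v\<close> consists of \<open>n3 + 1\<close> copies of \<open>A\<close> followed by \<open>C\<close>. Clustering of a word
  means that the last letters of its conjugates are monotone in the conjugates
  (\<open>clusters_for_iff_last_mono\<close>), and this is used twice. On the one hand it yields an order
  condition on the factors \<open>x z y\<close> with a common middle \<open>z\<close> (\<open>clusters_for_order_condition\<close>).
  The extensions of three bispecial words, the empty word, the last one for a rule \<open>(b)\<close>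
  before the first rule \<open>(c)\<close>, and the one for this rule \<open>(c)\<close>, are incompatible, since each
  of them asks that a different letter not be in the middle of the alphabet. Two short factors
  contain enough of these extensions (\<open>conflict_words_not_clustering\<close>), and they recur so
  densely that every word of the language longer than \<open>v\<close> contains one of them
  (\<open>long_factor_not_clustering\<close>). On the other hand it shows that a word that codes a periodic
  orbit of a discrete interval exchange clusters (\<open>clusters_for_interval_exchange\<close>), and \<open>v\<close>
  codes an orbit of an exchange of three intervals (\<open>coded_vword\<close>).
\<close>

section \<open>Clustering and last letters of ordered conjugates\<close>

abbreviation letter_le :: "'a list \<Rightarrow> 'a \<Rightarrow> 'a \<Rightarrow> bool" where
  "letter_le as x y \<equiv> x = y \<or> (x, y) \<in> letter_less as"

text \<open>
  The order on letters inherits the linear order axioms from the lexicographical order on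
  words of length one.
\<close>
lemma linorder_letter_le:
  assumes "letter_order as"
  shows "class.linorder (letter_le as) (\<lambda>x y. (x, y) \<in> letter_less as)"
proof -
  interpret lex: linorder "lex_le as" "\<lambda>u v. (u, v) \<in> lexord (letter_less as)"
    by (rule linorder_lex_le[OF assms])
  have le: "letter_le as x y \<longleftrightarrow> lex_le as [x] [y]" for x y
    by (auto simp: lex_le_def)
  have less: "(x, y) \<in> letter_less as \<longleftrightarrow> ([x], [y]) \<in> lexord (letter_less as)" for x y
    by simp
  show ?thesis
    unfolding le unfolding less
  proof
    show "x = y" if "lex_le as [x] [y]" "lex_le as [y] [x]" for x y
      using lex.order.antisym[OF that] by simp
  qed (rule lex.less_le_not_le lex.order_refl lex.linear lex.order_trans, assumption?)+
qed

lemma letter_order_map_bij: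
  assumes "letter_order as" "bij \<pi>"
  shows "letter_order (map \<pi> as)"
  using assms by (auto simp: letter_order_def distinct_map bij_def intro: inj_on_subset)

lemma sorted_wrt_concat_replicate:
  assumes "sorted_wrt R xs" "\<And>x. R x x"
  shows "sorted_wrt R (concat (map (\<lambda>x. replicate (f x) x) xs))"
proof -
  have rep: "sorted_wrt R (replicate n x)" for n x
    using assms(2) by (auto simp: sorted_wrt_iff_nth_less)
  show ?thesis
    using assms(1) by (induction xs) (auto simp: sorted_wrt_append rep)
qed

lemma mset_concat_replicate_count:
  assumes "distinct xs" "set ys \<subseteq> set xs"
  shows "mset (concat (map (\<lambda>x. replicate (count_list ys x) x) xs)) = mset ys"
proof (rule multiset_eqI)
  fix a
  have "count (mset (concat (map (\<lambda>x. replicate (g x) x) xs))) a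
      = (if a \<in> set xs then g a else 0)" for g :: "'a \<Rightarrow> nat"
    using assms(1) by (induction xs) (auto simp: count_replicate_mset)
  moreover have "count (mset ys) a = count_list ys a"
    by (induction ys) auto
  ultimately show "count (mset (concat (map (\<lambda>x. replicate (count_list ys x) x) xs))) a
      = count (mset ys) a"
    using assms(2) by (auto simp: count_list_0_iff)
qed

lemma sorted_conjugates_props:
  assumes "letter_order as"
  shows "mset (sorted_conjugates as w) = mset (conjugates w)"
    and "sorted_wrt (lex_le as) (sorted_conjugates as w)"
  using theI'[OF sorted_conjugates_ex1[OF assms, of w]] by (auto simp: sorted_conjugates_def)

lemma last_rotate:
  assumes "i < length w"
  shows "last (rotate i w) = w ! ((i + (length w - 1)) mod length w)"
proof -
  have "rotate i w \<noteq> []" using assms by auto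
  then have "last (rotate i w) = rotate i w ! (length w - 1)" by (simp add: last_conv_nth)
  then show ?thesis using assms by (simp add: nth_rotate)
qed

lemma mset_last_conjugates: "mset (map last (conjugates w)) = mset w"
proof (cases w rule: rev_cases)
  case (snoc v x)
  have "last (rotate i w) = (if i = 0 then x else v ! (i - 1))" if "i < length w" for i
  proof (cases i)
    case 0
    then show ?thesis using snoc by simp
  next
    case (Suc k)
    have shift: "i + (length w - 1) = k + length w" using that unfolding Suc by linarith
    have "last (rotate i w) = w ! ((k + length w) mod length w)"
      unfolding last_rotate[OF that] shift ..
    then have "last (rotate i w) = w ! k" using that unfolding Suc by simp
    moreover have "w ! k = v ! k" using that unfolding snoc Suc by (simp add: nth_append)
    ultimately show ?thesis using Suc by simp
  qed
  then have "map last (conjugates w) = map (\<lambda>i. if i = 0 then x else v ! (i - 1)) [0..<length w]"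
    unfolding conjugates_def map_map by (intro map_cong) auto
  also have "\<dots> = x # v"
    using snoc by (simp add: map_upt_Suc map_nth del: upt_Suc)
  finally have "mset (map last (conjugates w)) = mset (x # v)" by (rule arg_cong)
  then show ?thesis unfolding snoc by simp
qed (simp add: conjugates_def)

text \<open>
  The word that a clustering word must have as its transform is the only rearrangement of \<open>w\<close>
  that is sorted for the order \<open>map \<pi> as\<close>, so clustering is a matter of sortedness alone.
\<close>
lemma clusters_for_iff_sorted_bwt:
  assumes "letter_order as" "bij \<pi>"
  shows "clusters_for as \<pi> w \<longleftrightarrow> sorted_wrt (letter_le (map \<pi> as)) (bwt as w)"
proof -
  let ?bs = "map \<pi> as"
  let ?target = "concat (map (\<lambda>b. replicate (count_list w b) b) ?bs)"
  have bs: "letter_order ?bs" by (rule letter_order_map_bij[OF assms])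
  interpret L: linorder "letter_le ?bs" "\<lambda>x y. (x, y) \<in> letter_less ?bs"
    by (rule linorder_letter_le[OF bs])
  have "sorted_wrt (letter_le ?bs) ?bs"
    unfolding sorted_wrt_iff_nth_less letter_less_def by blast
  then have sorted: "sorted_wrt (letter_le ?bs) ?target"
    by (rule sorted_wrt_concat_replicate) simp
  have m1: "mset (bwt as w) = mset w"
    using sorted_conjugates_props(1)[OF assms(1), of w] mset_last_conjugates[of w]
    by (simp add: bwt_def)
  have m2: "mset ?target = mset w"
    by (rule mset_concat_replicate_count) (use bs in \<open>auto simp: letter_order_def\<close>)
  have eq: "bwt as w = ?target" if "sorted_wrt (letter_le ?bs) (bwt as w)"
    using L.properties_for_sort[OF m1 that] L.properties_for_sort[OF m2 sorted] by (rule trans[OF sym])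
  have iff: "clusters_for as \<pi> w \<longleftrightarrow> bwt as w = ?target"
    by (simp add: clusters_for_def comp_def)
  show ?thesis
    unfolding iff
  proof (rule iffI)
    show "sorted_wrt (letter_le ?bs) (bwt as w)" if "bwt as w = ?target"
      unfolding that by (rule sorted)
  qed (rule eq)
qed

text \<open>
  Sortedness is transferred to pairs of conjugates, so that the list of sorted conjugates
  disappears. Equal conjugates have equal last letters, which is why only strictly ordered
  pairs have to be compared. Both the obstruction and the construction below start from this
  criterion.
\<close>
lemma clusters_for_iff_last_mono:
  assumes "letter_order as" "bij \<pi>"
  shows "clusters_for as \<pi> w \<longleftrightarrow>
    (\<forall>i<length w. \<forall>j<length w. (rotate i w, rotate j w) \<in> lexord (letter_less as)
      \<longrightarrow> letter_le (map \<pi> as) (last (rotate i w)) (last (rotate j w)))"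
    (is "_ \<longleftrightarrow> ?mono")
proof -
  let ?cs = "sorted_conjugates as w"
  interpret lex: linorder "lex_le as" "\<lambda>u v. (u, v) \<in> lexord (letter_less as)"
    by (rule linorder_lex_le[OF assms(1)])
  note cs = sorted_conjugates_props[OF assms(1), of w]
  have set_cs: "set ?cs = (\<lambda>i. rotate i w) ` {..<length w}"
    using mset_eq_setD[OF cs(1)] by (simp add: conjugates_def atLeast0LessThan)
  have "sorted_wrt (letter_le (map \<pi> as)) (bwt as w) \<longleftrightarrow>
      (\<forall>u\<in>set ?cs. \<forall>v\<in>set ?cs. (u, v) \<in> lexord (letter_less as)
        \<longrightarrow> letter_le (map \<pi> as) (last u) (last v))" (is "?L \<longleftrightarrow> ?R")
  proof
    assume L: ?L
    show ?R
    proof (intro ballI impI)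
      fix u v assume "u \<in> set ?cs" "v \<in> set ?cs" and uv: "(u, v) \<in> lexord (letter_less as)"
      then obtain p q where pq: "p < length ?cs" "?cs ! p = u" "q < length ?cs" "?cs ! q = v"
        by (metis in_set_conv_nth)
      have "p < q"
      proof (rule ccontr)
        assume "\<not> p < q"
        then have "lex_le as (?cs ! q) (?cs ! p)"
          using cs(2) pq(1) unfolding sorted_wrt_iff_nth_less lex_le_def
          by (cases "p = q") simp_all
        then have "lex_le as v u" unfolding pq(2,4) .
        with uv show False unfolding lex.not_le[symmetric] by (rule notE)
      qed
      then have "letter_le (map \<pi> as) (last (?cs ! p)) (last (?cs ! q))"
        using L pq(1,3) unfolding bwt_def sorted_wrt_iff_nth_less by simp
      then show "letter_le (map \<pi> as) (last u) (last v)" unfolding pq(2,4) .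
    qed
  next
    assume R: ?R
    have "letter_le (map \<pi> as) (last (?cs ! p)) (last (?cs ! q))"
      if "p < q" "q < length ?cs" for p q
    proof -
      have "lex_le as (?cs ! p) (?cs ! q)"
        using cs(2) that by (simp add: sorted_wrt_iff_nth_less)
      moreover have "?cs ! p \<in> set ?cs" "?cs ! q \<in> set ?cs" using that by simp_all
      ultimately show ?thesis using R unfolding lex_le_def by metis
    qed
    then show ?L by (simp add: bwt_def sorted_wrt_iff_nth_less)
  qed
  also have "?R \<longleftrightarrow> ?mono"
    unfolding set_cs ball_simps(9) by (simp only: Ball_def lessThan_iff)
  finally show ?thesis unfolding clusters_for_iff_sorted_bwt[OF assms] .
qed

text \<open>
  The conjugates that begin at the occurrences of \<open>z y\<close> and \<open>z y'\<close> are ordered by \<open>y\<close> and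
  \<open>y'\<close>, and they end with \<open>x\<close> and \<open>x'\<close>. This is the necessary half of the order condition on
  the bispecial words of a clustering word.
\<close>
lemma clusters_for_order_condition:
  assumes "letter_order as" "bij \<pi>" "clusters_for as \<pi> w"
    and "sublist (x # z @ [y]) w" "sublist (x' # z @ [y']) w" "(y, y') \<in> letter_less as"
  shows "letter_le (map \<pi> as) x x'"
proof -
  have rot: "\<exists>i<length w. \<exists>s. rotate i w = z @ e # s \<and> last (rotate i w) = d"
    if factor: "sublist (d # z @ [e]) w" for d e
  proof -
    from factor obtain p q where w: "w = (p @ [d]) @ (z @ e # q)"
      by (auto simp: sublist_def)
    have "rotate (length (p @ [d])) w = (z @ e # q) @ (p @ [d])"
      unfolding w by (rule rotate_append)
    moreover have "length (p @ [d]) < length w" using w by simp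
    ultimately show ?thesis by (intro exI[of _ "length (p @ [d])"]) auto
  qed
  obtain i s where i: "i < length w" "rotate i w = z @ y # s" "last (rotate i w) = x"
    using rot[OF assms(4)] by blast
  obtain j t where j: "j < length w" "rotate j w = z @ y' # t" "last (rotate j w) = x'"
    using rot[OF assms(5)] by blast
  have "(rotate i w, rotate j w) \<in> lexord (letter_less as)"
    unfolding i j using assms(6) by (intro lexord_append_leftI) simp
  moreover have "\<forall>i<length w. \<forall>j<length w. (rotate i w, rotate j w) \<in> lexord (letter_less as)
      \<longrightarrow> letter_le (map \<pi> as) (last (rotate i w)) (last (rotate j w))"
    using assms(3) unfolding clusters_for_iff_last_mono[OF assms(1,2)] .
  ultimately have "letter_le (map \<pi> as) (last (rotate i w)) (last (rotate j w))"
    using i(1) j(1) by blast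
  then show ?thesis unfolding i(3) j(3) .
qed

section \<open>Codings of discrete interval exchanges\<close>

text \<open>
  The orbit of \<open>x\<close> under the piecewise translation by \<open>\<tau> l\<close> on \<open>I l\<close> is coded by the given
  word.
\<close>
fun itinerary :: "('a \<Rightarrow> int set) \<Rightarrow> ('a \<Rightarrow> int) \<Rightarrow> int \<Rightarrow> 'a list \<Rightarrow> bool" where
  "itinerary I \<tau> x [] \<longleftrightarrow> True"
| "itinerary I \<tau> x (l # u) \<longleftrightarrow> x \<in> I l \<and> itinerary I \<tau> (x + \<tau> l) u"

lemma itinerary_append:
  "itinerary I \<tau> x (u @ v) \<longleftrightarrow> itinerary I \<tau> x u \<and> itinerary I \<tau> (x + sum_list (map \<tau> u)) v"
  by (induction u arbitrary: x) (auto simp: add.assoc)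

lemma itinerary_nth:
  assumes "itinerary I \<tau> x u" "i < length u"
  shows "x + sum_list (map \<tau> (take i u)) \<in> I (u ! i)"
proof -
  have "u = take i u @ u ! i # drop (Suc i) u"
    using assms(2) by (simp add: Cons_nth_drop_Suc)
  then show ?thesis using assms(1) by (metis itinerary_append itinerary.simps(2))
qed

text \<open>
  The conjugates of a word that codes a periodic orbit are attached to the points of the
  orbit. Two points in the same interval keep their distance, so the first difference between
  two conjugates shows the order of the points: lexicographical order forces the order of the
  points. The last letter of a conjugate tells in which translated interval its point lies,
  and the translated intervals are ordered by \<open>map \<pi> as\<close>.
\<close>
lemma clusters_for_interval_exchange:
  fixes I :: "'a \<Rightarrow> int set" and \<tau> :: "'a \<Rightarrow> int"
  assumes "letter_order as" "bij \<pi>"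
    and intervals: "\<And>l m x y. (l, m) \<in> letter_less as \<Longrightarrow> x \<in> I l \<Longrightarrow> y \<in> I m \<Longrightarrow> x < y"
    and images: "\<And>l m x y. (l, m) \<in> letter_less (map \<pi> as) \<Longrightarrow> x \<in> I l \<Longrightarrow> y \<in> I m
      \<Longrightarrow> x + \<tau> l < y + \<tau> m"
    and orbit: "itinerary I \<tau> x0 w" "sum_list (map \<tau> w) = 0"
  shows "clusters_for as \<pi> w"
proof -
  let ?n = "length w"
  define f where "f i = w ! (i mod ?n)" for i
  define pos where "pos i = x0 + sum_list (map \<tau> (take (i mod ?n) w))" for i
  interpret L: linorder "letter_le (map \<pi> as)" "\<lambda>x y. (x, y) \<in> letter_less (map \<pi> as)"
    by (rule linorder_letter_le[OF letter_order_map_bij[OF assms(1,2)]])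
  have pos_in: "pos i \<in> I (f i)" if "w \<noteq> []" for i
    using itinerary_nth[OF orbit(1), of "i mod ?n"] that by (simp add: pos_def f_def)
  have pos_Suc: "pos (Suc i) = pos i + \<tau> (f i)" if "w \<noteq> []" for i
  proof -
    have "sum_list (map \<tau> (take (Suc (i mod ?n)) w)) = sum_list (map \<tau> (take (i mod ?n) w)) + \<tau> (f i)"
      using that by (simp add: f_def take_Suc_conv_app_nth)
    then show ?thesis
      using orbit(2) by (auto simp: pos_def mod_Suc)
  qed
  show ?thesis
    unfolding clusters_for_iff_last_mono[OF assms(1,2)]
  proof (intro allI impI)
    fix i j
    assume ij: "i < ?n" "j < ?n" and less: "(rotate i w, rotate j w) \<in> lexord (letter_less as)"
    then have ne: "w \<noteq> []" by auto
    obtain k where k: "k < ?n" "take k (rotate i w) = take k (rotate j w)"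
      "(rotate i w ! k, rotate j w ! k) \<in> letter_less as"
      using less by (auto simp: lexord_take_index_conv)
    have same: "f (i + m) = f (j + m)" if "m < k" for m
      using arg_cong[OF k(2), of "\<lambda>u. u ! m"] that k(1) by (simp add: nth_rotate f_def)
    have "pos (i + m) - pos i = pos (j + m) - pos j" if "m \<le> k" for m
      using that by (induction m) (auto simp: pos_Suc[OF ne] same)
    moreover have "pos (i + k) < pos (j + k)"
      using intervals[OF _ pos_in[OF ne] pos_in[OF ne]] k by (simp add: nth_rotate f_def)
    ultimately have less_ij: "pos i < pos j" by fastforce
    \<comment> \<open>The predecessor of \<open>i\<close> modulo the length of \<open>w\<close>, without subtracting from \<open>i\<close>.\<close>
    have pos_pred: "pos i = pos (i + (?n - 1)) + \<tau> (f (i + (?n - 1)))" for i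
      using pos_Suc[OF ne, of "i + (?n - 1)"] ne
      by (simp add: pos_def flip: length_greater_0_conv)
    show "letter_le (map \<pi> as) (last (rotate i w)) (last (rotate j w))"
    proof (rule ccontr)
      assume "\<not> ?thesis"
      then have "(last (rotate j w), last (rotate i w)) \<in> letter_less (map \<pi> as)"
        by (meson L.not_le)
      then have "pos j < pos i"
        unfolding pos_pred[of i] pos_pred[of j]
        by (intro images pos_in[OF ne]) (use ij in \<open>simp add: last_rotate f_def\<close>)
      with less_ij show False by simp
    qed
  qed
qed

section \<open>The order condition expressed by ranks\<close>

lemma letter_order_rank:
  assumes "letter_order as"
  obtains p :: "'a \<Rightarrow> nat" where "inj p" "\<And>x y. (x, y) \<in> letter_less as \<longleftrightarrow> p x < p y"
proof -
  have "\<exists>i. i < length as \<and> as ! i = x" for x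
    using assms by (metis UNIV_I in_set_conv_nth letter_order_def)
  then obtain p where p: "\<And>x. p x < length as" "\<And>x. as ! p x = x" by metis
  have "(x, y) \<in> letter_less as \<longleftrightarrow> p x < p y" for x y
  proof
    assume "(x, y) \<in> letter_less as"
    then obtain i j where ij: "x = as ! i" "y = as ! j" "i < j" "j < length as"
      by (auto simp: letter_less_def)
    then have "p x = i" "p y = j"
      using assms p by (auto simp: letter_order_def simp flip: nth_eq_iff_index_eq)
    then show "p x < p y" using ij by simp
  next
    assume "p x < p y"
    then show "(x, y) \<in> letter_less as"
      using p[of x] p[of y] unfolding letter_less_def by force
  qed
  moreover have "inj p" using p(2) by (metis injI)
  ultimately show ?thesis using that by blast
qed

text \<open>
  Here \<open>p\<close> ranks the letters in the order used for sorting and \<open>q\<close> in the order in which they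
  appear in the transform. Numerical ranks leave the contradictions on three letters to linear
  arithmetic.
\<close>
lemma clustering_ranks:
  assumes "clustering u"
  obtains p q :: "'a \<Rightarrow> nat" where "inj p" "inj q"
    "\<And>x x' z y y'. sublist (x # z @ [y]) u \<Longrightarrow> sublist (x' # z @ [y']) u \<Longrightarrow> p y < p y' \<Longrightarrow> q x \<le> q x'"
proof -
  from assms obtain as \<pi> where as: "letter_order as" "bij \<pi>" "clusters_for as \<pi> u"
    by (auto simp: clustering_def)
  obtain p :: "'a \<Rightarrow> nat" where p: "inj p" "\<And>x y. (x, y) \<in> letter_less as \<longleftrightarrow> p x < p y"
    using letter_order_rank[OF as(1)] by blast
  obtain q :: "'a \<Rightarrow> nat"
    where q: "inj q" "\<And>x y. (x, y) \<in> letter_less (map \<pi> as) \<longleftrightarrow> q x < q y"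
    using letter_order_rank[OF letter_order_map_bij[OF as(1,2)]] by blast
  show ?thesis
    by (rule that[OF p(1) q(1)]) (use clusters_for_order_condition[OF as] p(2) q(2) in fastforce)
qed

section \<open>Lengths of the words of an AR system\<close>

lemma AR_word_length_pos: "0 < length (AR_word D k l)"
  by (induction k) auto

lemma AR_word_length_mono: "j \<le> k \<Longrightarrow> length (AR_word D j l) \<le> length (AR_word D k l)"
  by (induction k rule: dec_induct) auto

lemma AR_word_length_strict:
  assumes "j \<le> i" "i < k" "D i \<noteq> l"
  shows "length (AR_word D j l) < length (AR_word D k l)"
proof -
  have "length (AR_word D j l) \<le> length (AR_word D i l)" by (rule AR_word_length_mono[OF assms(1)])
  also have "\<dots> < length (AR_word D (Suc i) l)" using assms(3) AR_word_length_pos[of D i] by auto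
  also have "\<dots> \<le> length (AR_word D k l)" by (rule AR_word_length_mono) (use assms in simp)
  finally show ?thesis .
qed

abbreviation word_power :: "'a list \<Rightarrow> nat \<Rightarrow> 'a list" (infixr "\<up>" 80) where
  "u \<up> n \<equiv> concat (replicate n u)"

lemma length_word_power: "length (u \<up> n) = n * length u"
  by (induction n) auto

lemma word_power_comm: "u @ u \<up> n = u \<up> n @ u"
  by (induction n) auto

text \<open>
  A run of \<open>m\<close> equal rules appends the same word \<open>m\<close> times, since that word is kept during the
  run.
\<close>
lemma AR_word_run:
  assumes "\<And>i. k \<le> i \<Longrightarrow> i < k + m \<Longrightarrow> D i = l"
  shows "AR_word D (k + m) l' =
      (if l' = l then AR_word D k l else AR_word D k l' @ AR_word D k l \<up> m)"
    and "w_word D (k + m) = w_word D k @ AR_word D k l \<up> m"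
proof -
  have "(\<forall>l'. AR_word D (k + m) l' =
      (if l' = l then AR_word D k l else AR_word D k l' @ AR_word D k l \<up> m))
    \<and> w_word D (k + m) = w_word D k @ AR_word D k l \<up> m"
    using assms by (induction m) (simp_all add: word_power_comm)
  then show "AR_word D (k + m) l' =
      (if l' = l then AR_word D k l else AR_word D k l' @ AR_word D k l \<up> m)"
    and "w_word D (k + m) = w_word D k @ AR_word D k l \<up> m" by auto
qed

lemma Rabc_stages:
  assumes "AR_directive D" "Rabc D"
  shows "D 0 = La" "D (lambda2 D) = Lc" "i < lambda2 D \<Longrightarrow> D i \<noteq> Lc"
    "\<exists>i. 0 < i \<and> i < lambda2 D \<and> D i = Lb"
proof -
  have ex: "\<exists>k. D k = l" for l
    using assms(1) infinite_imp_nonempty[of "{k. D k = l}"] by (simp add: AR_directive_def)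
  show 0: "D 0 = La" using assms(2) by (simp add: Rabc_def)
  show c: "D (lambda2 D) = Lc" unfolding lambda2_def by (rule LeastI_ex) (rule ex)
  show "i < lambda2 D \<Longrightarrow> D i \<noteq> Lc"
    unfolding lambda2_def by (rule not_less_Least)
  define l where "l = (LEAST k. D k \<noteq> La)"
  have b: "D l = Lb" using assms(2) by (simp add: Rabc_def l_def)
  have "l \<le> lambda2 D" unfolding l_def using c by (intro Least_le) simp
  moreover have "l \<noteq> lambda2 D" "l \<noteq> 0" using b c 0 by (metis letter.distinct)+
  ultimately have "0 < l \<and> l < lambda2 D \<and> D l = Lb" using b by linarith
  then show "\<exists>i. 0 < i \<and> i < lambda2 D \<and> D i = Lb" ..
qed

lemma last_before_props:
  assumes "i < lambda2 D" "D i = l"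
  shows "last_before D l < lambda2 D" "D (last_before D l) = l"
    "last_before D l < j \<Longrightarrow> j < lambda2 D \<Longrightarrow> D j \<noteq> l"
proof -
  let ?P = "\<lambda>k. k < lambda2 D \<and> D k = l"
  have "?P (last_before D l)"
    unfolding last_before_def by (rule GreatestI_nat[of ?P i "lambda2 D"]) (use assms in auto)
  then show "last_before D l < lambda2 D" "D (last_before D l) = l" by auto
  assume j: "last_before D l < j" "j < lambda2 D"
  show "D j \<noteq> l"
  proof
    assume "D j = l"
    then have "j \<le> last_before D l"
      unfolding last_before_def using j(2) by (intro Greatest_le_nat[where b = "lambda2 D"]) auto
    with j(1) show False by simp
  qed
qed

lemma first_after_props:
  assumes "AR_directive D"
  shows "lambda2 D < first_after D l" "D (first_after D l) = l"
    "lambda2 D < j \<Longrightarrow> j < first_after D l \<Longrightarrow> D j \<noteq> l"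
proof -
  let ?P = "\<lambda>k. k > lambda2 D \<and> D k = l"
  have "infinite {k. D k = l}" using assms by (simp add: AR_directive_def)
  then have "\<exists>k. ?P k" by (metis (mono_tags, lifting) finite_nat_set_iff_bounded_le
    mem_Collect_eq not_le)
  then have "?P (first_after D l)" unfolding first_after_def by (rule LeastI_ex)
  then show "lambda2 D < first_after D l" "D (first_after D l) = l" by auto
  show "lambda2 D < j \<Longrightarrow> j < first_after D l \<Longrightarrow> D j \<noteq> l"
    unfolding first_after_def using not_less_Least[of j ?P] by auto
qed

lemma mu_string_props:
  assumes "0 < mu_y D"
  shows "mu_string D < mu_y D"
    "mu_string D \<le> i \<Longrightarrow> i < mu_y D \<Longrightarrow> D i = D (mu_y D - 1)"
proof -
  let ?P = "\<lambda>j. j < mu_y D \<and> (\<forall>i. j \<le> i \<and> i < mu_y D \<longrightarrow> D i = D (mu_y D - 1))"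
  have "i = mu_y D - 1" if "mu_y D - 1 \<le> i" "i < mu_y D" for i
    using that by linarith
  then have "?P (mu_y D - 1)" using assms by (metis diff_less zero_less_one)
  then have P: "?P (mu_string D)" unfolding mu_string_def by (rule LeastI)
  then show "mu_string D < mu_y D"
    "mu_string D \<le> i \<Longrightarrow> i < mu_y D \<Longrightarrow> D i = D (mu_y D - 1)" by blast+
qed

text \<open>
  Whichever of the three words are the shortest and the middle one, they are bounded by any
  two of the words listed by increasing length.
\<close>
lemma S_M_length_le:
  assumes "length (AR_word D k z) \<le> length (AR_word D k l)" "z \<noteq> l"
  shows "length (S_word D k) \<le> length (AR_word D k z)"
    and "length (M_word D k) \<le> length (AR_word D k l)"
  using assms by (cases z; cases l; auto simp: S_word_def M_word_def words_by_length_def)+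

text \<open>
  As long as only the rules \<open>(a)\<close> and \<open>(b)\<close> are used, each stage appends the same word to \<open>w\<close>,
  to \<open>C\<close> and to exactly one of \<open>A\<close> and \<open>B\<close>.
\<close>
lemma binary_prefix_lengths:
  assumes "\<And>i. i < k \<Longrightarrow> D i \<noteq> Lc"
  shows "length (AR_word D k La) + length (AR_word D k Lb) = length (w_word D k) + 2"
    and "length (AR_word D k Lc) = length (w_word D k) + 1"
proof -
  have "length (AR_word D k La) + length (AR_word D k Lb) = length (w_word D k) + 2
    \<and> length (AR_word D k Lc) = length (w_word D k) + 1"
    using assms
  proof (induction k)
    case (Suc k)
    then show ?case using Suc.prems[of k] by (cases "D k") auto
  qed simp
  then show "length (AR_word D k La) + length (AR_word D k Lb) = length (w_word D k) + 2"
    and "length (AR_word D k Lc) = length (w_word D k) + 1" by auto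
qed

text \<open>
  While the rule \<open>(y)\<close> is not used, the word of \<open>y\<close> grows at every stage, and by as much as
  the words of \<open>x\<close> and of \<open>c\<close> together.
\<close>
lemma balanced_lengths:
  assumes "{x, y} = {La, Lb}"
    and "length (AR_word D j x) + length (AR_word D j y) = length (AR_word D j Lc) + 1"
    and "\<And>i. j \<le> i \<Longrightarrow> i < k \<Longrightarrow> D i \<noteq> y" "j \<le> k"
  shows "length (AR_word D k y) + 2 * length (AR_word D j x)
      = length (AR_word D k x) + length (AR_word D k Lc) + 1"
  using assms(4,3)
proof (induction k rule: dec_induct)
  case base
  then show ?case using assms(2) by simp
next
  case (step k)
  have "D k \<noteq> y" using step.prems[of k] step.hyps by simp
  moreover have "y \<noteq> Lc" "x \<noteq> Lc" "x \<noteq> y" using assms(1) by (auto simp: doubleton_eq_iff)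
  ultimately have "D k = x \<or> D k = Lc" using assms(1) by (cases "D k") (auto simp: doubleton_eq_iff)
  moreover have "length (AR_word D k y) + 2 * length (AR_word D j x)
      = length (AR_word D k x) + length (AR_word D k Lc) + 1"
    using step by auto
  ultimately show ?case using \<open>y \<noteq> Lc\<close> \<open>x \<noteq> Lc\<close> \<open>x \<noteq> y\<close> by auto
qed

section \<open>Directive words that begin with prescribed blocks\<close>

lemma begins_with_append:
  "begins_with D (p @ q) \<longleftrightarrow> begins_with D p \<and> begins_with (\<lambda>i. D (length p + i)) q"
proof -
  have "[0..<length p + length q] = [0..<length p] @ map (\<lambda>i. length p + i) [0..<length q]"
    unfolding upt_add_eq_append[OF le0]
    using map_add_upt[of "length p" "length q"] by (simp only: add.commute)
  then have "map D [0..<length p + length q]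
      = map D [0..<length p] @ map (\<lambda>i. D (length p + i)) [0..<length q]"
    by (simp only: map_append map_map comp_def)
  moreover have "map D [0..<length p] @ w = p @ q \<longleftrightarrow> map D [0..<length p] = p \<and> w = q" for w
    by (rule append_eq_append_conv) simp
  ultimately show ?thesis by (simp only: begins_with_def length_append)
qed

lemma begins_with_replicate: "begins_with D (replicate n l) \<longleftrightarrow> (\<forall>i<n. D i = l)"
  by (simp add: begins_with_def list_eq_iff_nth_eq)

lemma begins_with_single: "begins_with D [l] \<longleftrightarrow> D 0 = l"
  by (simp add: begins_with_def)

lemma begins_with_blocks:
  "begins_with D ([La] @ replicate n1 Lb @ replicate n2 Lc @ replicate n3 La @ [Lb]) \<longleftrightarrow>
    D 0 = La \<and> (\<forall>i<n1. D (1 + i) = Lb) \<and> (\<forall>i<n2. D (1 + n1 + i) = Lc)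
    \<and> (\<forall>i<n3. D (1 + n1 + n2 + i) = La) \<and> D (1 + n1 + n2 + n3) = Lb"
  by (simp add: begins_with_append begins_with_replicate begins_with_single add.assoc
      del: append.simps replicate.simps)

section \<open>The gap for general directive words\<close>

text \<open>
  Write \<open>s\<close>, \<open>q\<close>, \<open>r\<close>, \<open>t\<close> for the stages \<open>\<lambda>\<^sub>2\<close>, \<open>\<lambda>\<^sub>y\<close>, \<open>\<mu>\<close>, \<open>\<mu>\<^sub>y\<close>, and let \<open>z'\<close> be the
  element of \<open>{x, c}\<close> other than \<open>z\<close>. Four relations between lengths express everything by
  \<open>X\<^sub>s\<close>, \<open>Z\<^sub>t\<close>, \<open>Z'\<^sub>r\<close> and \<open>Z'\<^sub>t\<close>: the length of \<open>X\<^sub>s\<close> exceeds that of \<open>w\<^sub>q\<close> by 2; the sum of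
  the lengths of \<open>Y\<^sub>t\<close> and twice \<open>X\<^sub>s\<close> exceeds that of \<open>X\<^sub>t\<close> and \<open>C\<^sub>t\<close> by 1; \<open>Z'\<^sub>t\<close> is \<open>Z'\<^sub>r\<close>
  followed by \<open>t - r\<close> copies of \<open>Z\<^sub>t\<close>; and the length of \<open>v\<close> is at most that of \<open>t - r + 1\<close>
  copies of \<open>Z\<^sub>t\<close> and one of \<open>Z'\<^sub>t\<close>. They bound the gap from below by the length of \<open>Z'\<^sub>r\<close>
  minus that of \<open>X\<^sub>s\<close> minus 1.

  If \<open>z = c\<close>, then \<open>X\<^sub>r\<close> contains \<open>X\<^sub>s\<close> followed by \<open>C\<^sub>s\<close>, and this bound is positive. If \<open>z =
  x\<close>, then \<open>C\<^sub>s\<close> is longer than \<open>X\<^sub>s\<close> by the length of \<open>Y\<^sub>s\<close> minus 1, and the bound can vanish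
  only if \<open>Y\<^sub>s\<close> has length 2 and \<open>C\<^sub>r\<close> is not longer than \<open>C\<^sub>s\<close>. The first condition means
  that \<open>y = b\<close> and that only the first of the stages before \<open>s\<close> uses the rule \<open>(a)\<close>; the
  second that only the rule \<open>(c)\<close> is used from \<open>s\<close> to \<open>r\<close>. Together they describe exactly the
  excluded prefixes.
\<close>
lemma v_length_gap:
  assumes "AR_directive D" "Rabc D"
    and not_special: "\<not> (\<exists>n1 n2 n3. n1 \<ge> 1 \<and> n2 \<ge> 1 \<and> n3 \<ge> 1 \<and>
      begins_with D ([La] @ replicate n1 Lb @ replicate n2 Lc @ replicate n3 La @ [Lb]))"
  shows "length (v_word D) < K_bound D - 1"
proof -
  define x where "x = x_letter D"
  define y where "y = y_letter D"
  define s where "s = lambda2 D"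
  define t where "t = mu_y D"
  define r where "r = mu_string D"
  define z where "z = D (t - 1)"
  define z' where "z' = (if z = Lc then x else Lc)"
  let ?len = "\<lambda>k l. length (AR_word D k l)"
  note st = Rabc_stages[OF assms(1,2), folded s_def]
  have xy: "{x, y} = {La, Lb}" "x \<noteq> y" "x \<noteq> Lc" "y \<noteq> Lc"
    by (auto simp: x_def y_def x_letter_def y_letter_def)
  have t: "t = first_after D y" by (simp add: t_def y_def mu_y_def)
  have fx: "first_after D x < t"
  proof -
    have "first_after D La \<noteq> first_after D Lb"
      using first_after_props(2)[OF assms(1)] by (metis letter.distinct(1))
    then show ?thesis
      unfolding t by (auto simp: x_def y_def x_letter_def y_letter_def)
  qed
  have s_fx: "s < first_after D x" "D (first_after D x) = x"
    using first_after_props[OF assms(1)] by (auto simp: s_def)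
  have st_less: "s < t" using fx s_fx by simp
  have Dt: "D t = y" using first_after_props(2)[OF assms(1)] by (simp add: t)
  have D_st: "D i = x \<or> D i = Lc" if "s \<le> i" "i < t" for i
  proof -
    have "D i \<noteq> y"
      using first_after_props(3)[OF assms(1), of i y] that st(2) xy by (cases "i = s") (auto simp: s_def t)
    then show ?thesis using xy(1) by (cases "D i") (auto simp: doubleton_eq_iff)
  qed
  have "z = x \<or> z = Lc"
    unfolding z_def by (rule D_st) (use st_less in linarith)+
  then have zz': "z = x \<and> z' = Lc \<or> z = Lc \<and> z' = x" "z \<noteq> z'"
    using xy(3) by (auto simp: z'_def)
  have "0 < mu_y D" using st_less unfolding t_def by linarith
  note mus = mu_string_props[OF this]
  have r: "r < t" "\<And>i. r \<le> i \<Longrightarrow> i < t \<Longrightarrow> D i = z"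
    unfolding r_def t_def z_def by (fact mus(1)) (fact mus(2))
  have s_r: "s < r" if "z = x"
    using r(2)[of s] that st(2) st_less xy by (cases "s < r") auto
  have s_r': "s < r" if "z = Lc"
    using r(2)[OF _ fx] s_fx that xy by (cases "s < r") auto
  have sr: "s < r" using s_r s_r' zz' by blast
  obtain i0 where i0: "i0 < s" "D i0 = y"
    using st xy(1) by (metis bot_nat_0.not_eq_extremum doubleton_eq_iff not_less_zero)
  note lb = last_before_props[of i0 D y, folded s_def, OF i0]
  let ?q = "last_before D y"
  have binary: "?len k x + ?len k y = length (w_word D k) + 2"
    "?len k Lc = length (w_word D k) + 1" if "k \<le> s" for k
    using binary_prefix_lengths[of k D] st(3) that xy(1)
    by (auto simp: doubleton_eq_iff)
  have X1: "?len s x = length (w_word D ?q) + 2"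
  proof -
    have "D i = x" if "Suc ?q \<le> i" "i < Suc ?q + (s - Suc ?q)" for i
    proof -
      have "?q < i" "i < s" using that lb(1) by simp_all
      then show ?thesis
        using lb(3)[of i] st(3)[of i] xy(1) by (cases "D i") (auto simp: doubleton_eq_iff)
    qed
    from AR_word_run(1)[of "Suc ?q" "s - Suc ?q" D x x, OF this]
    have "?len s x = ?len (Suc ?q) x" using lb(1) by simp
    then show ?thesis using binary(1)[of ?q] lb(1,2) xy(2) by simp
  qed
  have C1: "?len s Lc + 1 = ?len s x + ?len s y" using binary[of s] by simp
  have Y: "?len t y + 2 * ?len s x = ?len t x + ?len t Lc + 1"
    using balanced_lengths[OF xy(1), of D s t] C1 D_st st_less xy by fastforce
  have run: "?len t z' = ?len r z' + (t - r) * ?len t z"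
  proof -
    have "r + (t - r) = t" using r by simp
    with AR_word_run(1)[of r "t - r" D z] r(2) zz'(2) show ?thesis
      by (simp add: length_word_power)
  qed
  have "1 * ?len t z \<le> (t - r) * ?len t z" using r(1) by (intro mult_right_mono) auto
  then have Sz: "?len t z \<le> ?len t z'" unfolding run by linarith
  have "length (v_word D) = (t - r + 1) * length (S_word D t) + length (M_word D t)"
    unfolding v_word_def t_def r_def by (simp add: length_word_power)
  also have "\<dots> \<le> (t - r + 1) * ?len t z + ?len t z'"
    by (intro add_mono mult_left_mono S_M_length_le[OF Sz zz'(2)]) simp
  finally have v: "length (v_word D) \<le> (t - r) * ?len t z + ?len t z + ?len t z'" by simp
  have max: "max (?len (t + 1) Lc) (?len (t + 1) x) = ?len t z' + ?len t y"
    using zz'(1) Sz xy(2,4) by (auto simp: Dt)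
  have "K_bound D - 1 = length (w_word D ?q) + max (?len (t + 1) Lc) (?len (t + 1) x)"
    unfolding K_bound_def x_def y_def t_def by simp
  then have K: "K_bound D - 1 = ?len s x - 2 + (?len t z' + ?len t y)"
    unfolding max X1 by simp
  have "?len t x + ?len t Lc = ?len t z + ?len t z'" using zz' by auto
  with v K Y run X1 have reduce: "length (v_word D) < K_bound D - 1"
    if "?len s x + 1 < ?len r z'"
    using that by linarith
  have y3: "y = La \<Longrightarrow> 3 \<le> ?len s y" and b2: "2 \<le> ?len s Lb"
  proof -
    obtain i where i: "0 < i" "i < s" "D i = Lb" using st(4) by blast
    have B: "?len 1 Lb = 2" using st(1) by simp
    show "2 \<le> ?len s Lb" using AR_word_length_mono[of 1 s D Lb] B i by simp
    have "1 + 2 \<le> ?len i La + ?len i Lb"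
      using AR_word_length_mono[of 1 i D Lb] AR_word_length_pos[of D i La] B i(1) by linarith
    also have "\<dots> = ?len (Suc i) La" using i by simp
    also have "\<dots> \<le> ?len s La" by (rule AR_word_length_mono) (use i in simp)
    finally show "y = La \<Longrightarrow> 3 \<le> ?len s y" by simp
  qed
  have y2: "2 \<le> ?len s y" using y3 b2 xy(1) by (auto simp: doubleton_eq_iff)
  show ?thesis
  proof (cases "z = Lc")
    case True
    have "?len s x + 1 < ?len s x + ?len s Lc"
      using C1 y2 AR_word_length_pos[of D s x] by linarith
    also have "\<dots> = ?len (Suc s) x" using st(2) xy by simp
    also have "\<dots> \<le> ?len r x" by (rule AR_word_length_mono) (use sr in simp)
    finally show ?thesis using reduce zz' True xy by simp
  next
    case False
    then have z: "z = x" "z' = Lc" using zz' by auto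
    have C_mono: "?len s Lc \<le> ?len r Lc" by (rule AR_word_length_mono) (use sr in simp)
    show ?thesis
    proof (rule ccontr)
      assume "\<not> ?thesis"
      then have "?len r Lc \<le> ?len s x + 1" using reduce z by fastforce
      with C1 C_mono y2 have tight: "?len s y = 2" "?len r Lc = ?len s Lc" by linarith+
      have yb: "y = Lb" "x = La" using y3 tight xy(1) by (auto simp: doubleton_eq_iff)
      have D1: "D i = Lb" if "1 \<le> i" "i < s" for i
      proof (rule ccontr)
        assume "D i \<noteq> Lb"
        then have "?len 1 Lb < ?len s Lb" using AR_word_length_strict that by metis
        then show False using tight yb st(1) by simp
      qed
      have D2: "D i = Lc" if "s \<le> i" "i < r" for i
        using AR_word_length_strict[of s i r D Lc] tight that by fastforce
      have "s > 1" using st(4) by auto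
      have "begins_with D ([La] @ replicate (s - 1) Lb @ replicate (r - s) Lc @ replicate (t - r) La @ [Lb])"
        unfolding begins_with_blocks
      proof (intro conjI allI impI)
        show "D (1 + i) = Lb" if "i < s - 1" for i
          using that \<open>s > 1\<close> by (intro D1) linarith+
        show "D (1 + (s - 1) + i) = Lc" if "i < r - s" for i
          using that \<open>s > 1\<close> sr by (intro D2) linarith+
        show "D (1 + (s - 1) + (r - s) + i) = La" if "i < t - r" for i
          unfolding yb(2)[symmetric] z(1)[symmetric]
          by (rule r(2)) (use that \<open>s > 1\<close> sr r(1) in linarith)+
        have "1 + (s - 1) + (r - s) + (t - r) = t" using \<open>s > 1\<close> sr r(1) by linarith
        then show "D (1 + (s - 1) + (r - s) + (t - r)) = Lb" unfolding yb(1)[symmetric] by (simp only: Dt)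
      qed (rule st(1))
      moreover have "s - 1 \<ge> 1" "r - s \<ge> 1" "t - r \<ge> 1" using \<open>s > 1\<close> sr r(1) by auto
      ultimately show False using not_special by blast
    qed
  qed
qed

section \<open>Factors that violate the order condition\<close>

lemma suffix_power_Suc: "suffix u (u \<up> Suc n)"
  by (metis replicate_Suc concat.simps(2) word_power_comm suffixI)

lemma sublist_across:
  assumes "suffix p u" "prefix q v"
  shows "sublist (p @ q) (u @ v)"
  using assms unfolding suffix_def prefix_def sublist_def by (metis append_assoc)

text \<open>
  The palindromes \<open>a(ba)\<^sup>n\<close> are the words \<open>w\<^sub>k\<close>, from stage 1 up to the stage of the first
  rule \<open>(c)\<close>, for a directive word that begins with \<open>a b\<^sup>m c\<close>.
\<close>
definition pal :: "nat \<Rightarrow> letter list" where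
  "pal n = La # [Lb, La] \<up> n"

lemma pal_Suc: "pal (Suc n) = [La, Lb] @ pal n" "pal (Suc n) = pal n @ [Lb, La]"
  using word_power_comm[of "[Lb, La]" n] by (simp_all add: pal_def)

lemma length_pal: "length (pal n) = 2 * n + 1"
  by (simp add: pal_def length_word_power)

text \<open>
  The extensions of the empty word force \<open>b\<close> and \<open>c\<close> to lie on the same side of \<open>a\<close> in the
  order of \<open>p\<close>, and on the opposite side in the order of \<open>q\<close>. Those of \<open>z\<close> do the same for \<open>a\<close>
  and \<open>c\<close> with respect to \<open>b\<close>, so \<open>c\<close> is the middle letter in both orders. The extensions of
  \<open>z'\<close> would put \<open>a\<close> and \<open>b\<close> on the same side of \<open>c\<close>. The two alternatives are exchanged by
  reversing all words.
\<close>
lemma letter_order_conflict: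
  assumes "sublist [La, Lb] u" "sublist [Lb, La] u" "sublist [La, Lc] u" "sublist [Lc, La] u"
    and "sublist (Lb # z @ [Lc]) u" "sublist (Lc # z @ [Lb]) u"
    and "sublist (La # z @ [Lb]) u \<and> sublist (La # z' @ [Lc]) u \<and> sublist (Lc # z' @ [Lb]) u
      \<or> sublist (Lb # z @ [La]) u \<and> sublist (Lb # z' @ [Lc]) u \<and> sublist (Lc # z' @ [La]) u"
  shows "\<not> clustering u"
proof
  assume "clustering u"
  then obtain p q :: "letter \<Rightarrow> nat" where inj: "inj p" "inj q"
    and order: "\<And>x x' z y y'. sublist (x # z @ [y]) u \<Longrightarrow> sublist (x' # z @ [y']) u
      \<Longrightarrow> p y < p y' \<Longrightarrow> q x \<le> q x'"
    using clustering_ranks by metis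
  have dist: "p La \<noteq> p Lb" "p La \<noteq> p Lc" "p Lb \<noteq> p Lc" "q La \<noteq> q Lb" "q La \<noteq> q Lc" "q Lb \<noteq> q Lc"
    using inj by (auto dest: injD)
  have cond: "p y < p y' \<longleftrightarrow> q x < q x'"
    if "sublist (x # z @ [y]) u" "sublist (x' # z @ [y']) u" "x \<noteq> x'" "y \<noteq> y'" for x x' y y' z
  proof -
    have "q x \<noteq> q x'" "p y \<noteq> p y'" using that(3,4) inj by (auto dest: injD)
    then show ?thesis using order[OF that(1,2)] order[OF that(2,1)] by linarith
  qed
  have empty: "p Lb < p La \<longleftrightarrow> q La < q Lb" "p Lb < p La \<longleftrightarrow> q La < q Lc"
    "p Lc < p La \<longleftrightarrow> q La < q Lb"
    using cond[of La "[]" Lb Lb La] cond[of La "[]" Lb Lc La] cond[of La "[]" Lc Lb La] assms(1-4)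
    by simp_all
  have z: "p Lb < p Lc \<longleftrightarrow> q Lc < q Lb"
    using cond[OF assms(6,5)] by simp
  from assms(7) show False
  proof
    assume *: "sublist (La # z @ [Lb]) u \<and> sublist (La # z' @ [Lc]) u \<and> sublist (Lc # z' @ [Lb]) u"
    have "p Lb < p Lc \<longleftrightarrow> q La < q Lb" using cond[of La z Lb Lb Lc] * assms(5) by simp
    moreover have "p Lc < p Lb \<longleftrightarrow> q La < q Lc" using cond[of La z' Lc Lc Lb] * by simp
    ultimately show False using empty z dist by linarith
  next
    assume *: "sublist (Lb # z @ [La]) u \<and> sublist (Lb # z' @ [Lc]) u \<and> sublist (Lc # z' @ [La]) u"
    have "p Lb < p La \<longleftrightarrow> q Lc < q Lb" using cond[of Lc z Lb Lb La] * assms(6) by simp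
    moreover have "p Lc < p La \<longleftrightarrow> q Lb < q Lc" using cond[of Lb z' Lc Lc La] * by simp
    ultimately show False using empty z dist by linarith
  qed
qed

text \<open>
  For \<open>n = k + 1\<close>, the previous lemma applies with \<open>z\<close> and \<open>z'\<close> the palindromes \<open>pal k\<close> and
  \<open>pal n\<close>. All the extensions needed already occur in the first or the last \<open>pal n\<close> together
  with its two neighbours, because \<open>pal n\<close> is \<open>ab\<close> followed by \<open>pal k\<close> and also \<open>pal k\<close>
  followed by \<open>ba\<close>.
\<close>
lemma conflict_words_not_clustering:
  assumes "1 \<le> n" "1 \<le> m"
    and "sublist (La # pal n @ (Lc # pal n) \<up> m @ [Lb]) u
      \<or> sublist (Lb # pal n @ (Lc # pal n) \<up> m @ [La]) u"
  shows "\<not> clustering u"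
proof -
  obtain k where n: "n = Suc k" using assms(1) by (cases n) auto
  obtain j where m: "m = Suc j" using assms(2) by (cases m) auto
  have left: "(Lc # pal n) \<up> m = (Lc # pal n) @ (Lc # pal n) \<up> j"
    and right: "(Lc # pal n) \<up> m = (Lc # pal n) \<up> j @ (Lc # pal n)"
    unfolding m using word_power_comm[of "Lc # pal n" j] by simp_all
  have start: "sublist (x # pal n @ [Lc]) (x # pal n @ (Lc # pal n) \<up> m @ [y])" for x y
    unfolding left sublist_def by (rule exI[of _ "[]"]) simp
  have finish: "sublist (Lc # pal n @ [y]) (x # pal n @ (Lc # pal n) \<up> m @ [y])" for x y
    unfolding right sublist_def by (rule exI[of _ "x # pal n @ (Lc # pal n) \<up> j"]) simp
  have sub1: "sublist v (pal n @ [y]) \<Longrightarrow> sublist v (x # pal n @ [y])" for v x y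
    by (simp add: sublist_Cons_right)
  have sub2: "sublist v (x # pal n) \<Longrightarrow> sublist v (x # pal n @ [y])" for v x y
    using sublist_append[of v "x # pal n" "[y]"] by simp
  have ab: "sublist [La, Lb] (x # pal n)" for x
    unfolding n pal_Suc(1) sublist_def by (rule exI[of _ "[x]"]) simp
  have ba: "sublist [Lb, La] (x # pal n)" for x
    unfolding n pal_Suc(2) sublist_def by (rule exI[of _ "x # pal k"]) simp
  have ay: "sublist [La, y] (pal n @ [y])" for y
    unfolding n pal_Suc(2) sublist_def by (rule exI[of _ "pal k @ [Lb]"]) simp
  have xa: "sublist [x, La] (x # pal n)" for x
    unfolding pal_def sublist_def by (rule exI[of _ "[]"]) simp
  have xzb: "sublist (x # pal k @ [Lb]) (x # pal n)" for x
    unfolding n pal_Suc(2) sublist_def by (rule exI[of _ "[]"]) simp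
  have bzy: "sublist (Lb # pal k @ [y]) (pal n @ [y])" for y
    unfolding n pal_Suc(1) sublist_def by (rule exI[of _ "[La]"]) simp
  show ?thesis
    using assms(3)
  proof
    assume u: "sublist (La # pal n @ (Lc # pal n) \<up> m @ [Lb]) u"
    have ac: "sublist (La # pal n @ [Lc]) u" and cb: "sublist (Lc # pal n @ [Lb]) u"
      using sublist_order.order.trans[OF start u] sublist_order.order.trans[OF finish u] by auto
    note tr1 = sublist_order.order.trans[OF _ ac] and tr2 = sublist_order.order.trans[OF _ cb]
    show ?thesis
      by (rule letter_order_conflict[of u "pal k" "pal n"])
        (use tr1[OF sub2[OF ab]] tr1[OF sub2[OF ba]] tr1[OF sub1[OF ay]] tr2[OF sub2[OF xa]]
          tr1[OF sub1[OF bzy]] tr2[OF sub2[OF xzb]] tr1[OF sub2[OF xzb]] ac cb in blast)+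
  next
    assume u: "sublist (Lb # pal n @ (Lc # pal n) \<up> m @ [La]) u"
    have bc: "sublist (Lb # pal n @ [Lc]) u" and ca: "sublist (Lc # pal n @ [La]) u"
      using sublist_order.order.trans[OF start u] sublist_order.order.trans[OF finish u] by auto
    note tr1 = sublist_order.order.trans[OF _ bc] and tr2 = sublist_order.order.trans[OF _ ca]
    show ?thesis
      by (rule letter_order_conflict[of u "pal k" "pal n"])
        (use tr1[OF sub2[OF ab]] tr1[OF sub2[OF ba]] tr1[OF sub1[OF ay]] tr2[OF sub2[OF xa]]
          tr1[OF sub1[OF bzy]] tr2[OF sub2[OF xzb]] tr2[OF sub1[OF bzy]] bc ca in blast)+
  qed
qed

section \<open>Blocks of the extremal directive words\<close>

text \<open>
  The three words \<open>A\<close>, \<open>B\<close>, \<open>C\<close> after the rules \<open>a b\<^sup>n\<^sup>1 c\<^sup>n\<^sup>2 a\<^sup>n\<^sup>3\<close> are given explicitly, in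
  order to study their products without reference to a directive word. The auxiliary word
  \<open>cpal\<close> is \<open>C\<close> at the stage of the first rule \<open>(c)\<close>.
\<close>
locale extremal_blocks =
  fixes n1 n2 n3 :: nat
  assumes pos: "1 \<le> n1" "1 \<le> n2" "1 \<le> n3"
begin

definition cpal :: "letter list" where "cpal = Lc # pal n1"
definition blockA :: "letter list" where "blockA = pal n1 @ cpal \<up> n2"
definition blockB :: "letter list" where "blockB = [Lb, La] @ cpal \<up> n2 @ blockA \<up> n3"
definition blockC :: "letter list" where "blockC = cpal @ blockA \<up> n3"

lemma block_lengths:
  "length blockA = 2 * n1 + 1 + n2 * (2 * n1 + 2)"
  "length blockB = 2 + n2 * (2 * n1 + 2) + n3 * length blockA"
  "length blockC = 2 * n1 + 2 + n3 * length blockA"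
  by (simp_all add: blockA_def blockB_def blockC_def cpal_def length_pal length_word_power)

lemma block_length_bounds: "length blockA \<le> n3 * length blockA" "2 * n1 + 2 \<le> n2 * (2 * n1 + 2)"
  using pos mult_right_mono[of 1 n3 "length blockA"] mult_right_mono[of 1 n2 "2 * n1 + 2"]
  by simp_all

lemma block_length_order: "length blockA < length blockC" "length blockC < length blockB"
  using block_length_bounds pos unfolding block_lengths(2,3) by linarith+

lemma suffix_pal_blocks:
  "suffix (pal n1) blockA" "suffix (pal n1) blockB" "suffix (pal n1) blockC"
proof -
  have c: "suffix (pal n1) cpal" by (simp add: cpal_def suffix_ConsI)
  have "suffix cpal (cpal \<up> n2)" "suffix blockA (blockA \<up> n3)"
    using pos suffix_power_Suc[of _ "n2 - 1"] suffix_power_Suc[of _ "n3 - 1"] by auto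
  then show A: "suffix (pal n1) blockA" "suffix (pal n1) blockB" "suffix (pal n1) blockC"
    using c unfolding blockA_def[symmetric] blockB_def blockC_def
    by (metis append_assoc blockA_def suffix_appendI suffix_order.trans)+
qed

text \<open>
  The blocks \<open>B\<close> and \<open>C\<close> end with \<open>A\<close>, and what precedes this last \<open>A\<close> in them ends with \<open>a\<close>,
  as does every block. Hence \<open>aAb\<close>, which violates the order condition, occurs at the first
  letter of each block \<open>B\<close> that follows a block \<open>B\<close>, possibly with another block in between.
\<close>
lemma suffix_La_blockA:
  assumes "x \<in> {[], blockA, blockC}"
  shows "suffix (La # blockA) (blockB @ x)"
proof -
  have La: "suffix [La] (pal n1)"
    using pos pal_Suc(2)[of "n1 - 1"] by (simp add: suffix_def)
  have n3: "blockA \<up> n3 = blockA \<up> (n3 - 1) @ blockA"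
    using pos word_power_comm[of blockA "n3 - 1"] by (cases n3) auto
  have ends: "suffix (pal n1) (u @ blockA \<up> k)" if "suffix (pal n1) u" for u k
    using that suffix_pal_blocks(1)
    by (cases k) (auto simp: word_power_comm suffix_appendI simp flip: append_assoc)
  have step: "suffix (La # blockA) (u @ blockA)" if "suffix (pal n1) u" for u
    using suffix_order.trans[OF La that] by (auto simp: suffix_def)
  have "suffix (pal n1) cpal" by (simp add: cpal_def suffix_ConsI)
  moreover have "suffix (pal n1) ([Lb, La] @ cpal \<up> n2)"
    using calculation pos suffix_power_Suc[of cpal "n2 - 1"]
    by (metis Suc_diff_le diff_Suc_1 suffix_appendI suffix_order.trans One_nat_def)
  ultimately have "suffix (La # blockA) blockB" "suffix (La # blockA) blockC"
    using step[OF ends, of "[Lb, La] @ cpal \<up> n2" "n3 - 1"] step[OF ends, of cpal "n3 - 1"]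
    by (simp_all add: blockB_def blockC_def n3)
  then show ?thesis
    using assms step[OF suffix_pal_blocks(2)] by (auto intro: suffix_appendI)
qed

text \<open>
  After the next rule \<open>(b)\<close> every word is a product of \<open>AB\<close>, \<open>B\<close> and \<open>CB\<close>. Around the first
  letter of each block \<open>B\<close> two forbidden factors occur: \<open>aAb\<close> ends at this letter, and \<open>s t\<close>
  straddles the beginning of the block, with \<open>s = (ba)\<^sup>n\<^sup>1\<close> before it and \<open>t\<close> a prefix of \<open>B\<close>.
  A long factor that avoids all of them starts after the beginning of some occurrence of \<open>s t\<close>
  and stops before the first letter of the next block \<open>B\<close>; the largest distance between these
  places is the length of \<open>CB\<close> plus \<open>2 n1 - 1\<close>. Induction on the number of blocks reduces the
  claim to factors that end inside the last pair of blocks.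
\<close>
lemma long_factor_not_clustering:
  assumes "sublist u (concat (map (\<lambda>x. x @ blockB) xs))" "set xs \<subseteq> {[], blockA, blockC}"
    and "2 * n1 + length (blockC @ blockB) \<le> length u"
  shows "\<not> clustering u"
  using assms(1,2)
proof (induction xs rule: rev_induct)
  case Nil
  then show ?case using assms(3) pos by simp
next
  case (snoc x xs)
  let ?T = "concat (map (\<lambda>x. x @ blockB) xs)"
  define s where "s = [Lb, La] \<up> n1"
  define t where "t = [Lb, La] @ cpal \<up> n2 @ [La]"
  have x: "x \<in> {[], blockA, blockC}" using snoc.prems(2) by simp
  have st_lengths: "length s = 2 * n1" "length t + 2 * n1 = length blockA + 2"
    by (simp_all add: s_def t_def block_lengths length_word_power cpal_def length_pal)
  have len_x: "length x \<le> length blockC"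
    using x block_length_order(1) by auto
  have s_suffix: "suffix s v" if "suffix (pal n1) v" for v
    by (rule suffix_order.trans[OF _ that]) (simp add: s_def pal_def suffix_ConsI)
  have forbidden1: "\<not> clustering u" if "sublist (La # blockA @ [Lb]) u"
    using conflict_words_not_clustering[of n1 n2 u] pos that by (simp add: blockA_def cpal_def)
  have forbidden2: "\<not> clustering u" if "sublist (s @ t) u"
  proof -
    have "s @ t = Lb # pal n1 @ (Lc # pal n1) \<up> n2 @ [La]"
      using word_power_comm[of "[Lb, La]" n1] by (simp add: s_def t_def pal_def cpal_def)
    then show ?thesis using conflict_words_not_clustering[of n1 n2 u] pos that by simp
  qed
  have t_prefix: "prefix t blockB"
  proof -
    have "prefix [La] (blockA \<up> n3)"
      using pos by (cases n3) (simp_all add: blockA_def pal_def)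
    then show ?thesis by (simp add: t_def blockB_def)
  qed
  have "sublist u (?T @ (x @ blockB))" using snoc.prems(1) by simp
  then consider "sublist u ?T" | "sublist u (x @ blockB)"
    | u1 u2 where "u = u1 @ u2" "suffix u1 ?T" "prefix u2 (x @ blockB)"
    unfolding sublist_append by blast
  then show ?case
  proof cases
    case 1
    then show ?thesis using snoc by simp
  next
    case 2
    then have "length u \<le> length (x @ blockB)" by (rule sublist_length_le)
    then show ?thesis using assms(3) len_x pos(1) by simp
  next
    case (3 u1 u2)
    have len_u: "2 * n1 + length blockC + length blockB \<le> length u1 + length u2"
      using assms(3) 3(1) by simp
    have "length u2 \<le> length x + length blockB" using prefix_length_le[OF 3(3)] by simp
    then have "u1 \<noteq> []" using len_u len_x pos(1) by auto
    then have "xs \<noteq> []" using 3(2) by auto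
    then obtain ys y where xs: "xs = ys @ [y]" by (metis rev_exhaust)
    define T0 where "T0 = concat (map (\<lambda>x. x @ blockB) ys) @ y"
    have T: "?T = T0 @ blockB" by (simp add: xs T0_def)
    show ?thesis
    proof (cases "length u2 \<le> length x")
      case True
      \<comment> \<open>The factor does not reach the last block \<open>B\<close>, so it covers the whole previous one.\<close>
      then have len_u1: "2 * n1 + length blockB \<le> length u1" using len_u len_x by linarith
      have "T0 \<noteq> []" using suffix_length_le[OF 3(2)] len_u1 pos(1) by (auto simp: T)
      moreover have "y \<in> {[], blockA, blockC}" using snoc.prems(2) xs by simp
      ultimately have "suffix (pal n1) T0"
        using suffix_pal_blocks
        by (cases ys rule: rev_cases) (auto simp: T0_def suffix_appendI)
      then have "suffix (s @ blockB) ?T" using s_suffix by (auto simp: T suffix_def)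
      then have "suffix (s @ blockB) u1"
        by (rule suffix_length_suffix[OF _ 3(2)]) (use len_u1 st_lengths in simp)
      moreover have "sublist (s @ t) (s @ blockB)" using t_prefix by simp
      ultimately have "sublist (s @ t) u"
        unfolding 3(1) by (metis sublist_appendI sublist_order.order.trans suffix_imp_sublist sublist_append)
      then show ?thesis by (rule forbidden2)
    next
      case False
      \<comment> \<open>The factor contains the first letter of the last block \<open>B\<close>. If too little of it
        precedes this letter for \<open>aAb\<close>, then enough follows for \<open>s t\<close>.\<close>
      then obtain u3 where u2: "u2 = x @ u3" "prefix u3 blockB" "u3 \<noteq> []"
        using 3(3) prefix_length_le[of u2 x] by (auto simp: prefix_append)
      have u: "u = (u1 @ x) @ u3" using 3(1) u2(1) by simp
      have suf: "suffix (u1 @ x) (?T @ x)" using 3(2) by (simp add: suffix_def)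
      show ?thesis
      proof (cases "length blockA < length (u1 @ x)")
        case True
        have "suffix (La # blockA) (?T @ x)"
          unfolding T append_assoc by (rule suffix_appendI[OF suffix_La_blockA[OF x]])
        then have "suffix (La # blockA) (u1 @ x)"
          by (rule suffix_length_suffix[OF _ suf]) (use True in simp)
        moreover have "prefix [Lb] u3"
          using u2(2,3) by (cases u3) (auto simp: blockB_def)
        ultimately have "sublist ((La # blockA) @ [Lb]) u"
          unfolding u by (rule sublist_across)
        then show ?thesis by (intro forbidden1) simp
      next
        case False
        have "length u3 \<le> length blockB" using u2(2) by (rule prefix_length_le)
        then have "length s \<le> length (u1 @ x)"
          using len_u u2(1) st_lengths by simp
        moreover have "suffix (pal n1) (?T @ x)"
          using x suffix_pal_blocks by (auto simp: T suffix_appendI)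
        ultimately have "suffix s (u1 @ x)"
          using suffix_length_suffix[OF s_suffix suf] by blast
        moreover have "length t \<le> length u3"
          using False len_u u2(1) st_lengths block_length_bounds
          unfolding block_lengths(2,3) block_lengths(1) by simp
        then have "prefix t u3" using prefix_length_prefix[OF t_prefix u2(2)] by blast
        ultimately show ?thesis
          using forbidden2 sublist_across[of s "u1 @ x" t u3] unfolding u by blast
      qed
    qed
  qed
qed

section \<open>The maximal clustering word as an interval exchange coding\<close>

definition vword :: "letter list" where "vword = blockA \<up> (n3 + 1) @ blockC"

text \<open>
  The word \<open>v\<close> is exactly one letter shorter than the length from which clustering is
  excluded.
\<close>
lemma length_vword: "length vword + 1 = 2 * n1 + length (blockC @ blockB)"
  using pos(1) by (simp add: vword_def length_word_power block_lengths algebra_simps)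

text \<open>
  The word \<open>v\<close> is a conjugate of \<open>cpal\<close> followed by \<open>N\<close> copies of \<open>A\<close>, and \<open>Q\<close> is the number
  of palindromes \<open>pal n1\<close> in this product. So \<open>v\<close> contains \<open>(n1 + 1) Q\<close> letters \<open>a\<close>, \<open>n1 Q\<close>
  letters \<open>b\<close> and \<open>Q - N\<close> letters \<open>c\<close>. These are the lengths of the intervals below, arranged
  in the order \<open>a\<close>, \<open>c\<close>, \<open>b\<close>, and the translations rearrange the intervals in the opposite
  order.
\<close>
definition N :: int where "N = 2 * int n3 + 1"
definition Q :: int where "Q = (1 + int n2) * N + 1"

fun shift :: "letter \<Rightarrow> int" where
  "shift La = (int n1 + 1) * Q - N"
| "shift Lb = N - (int n1 + 2) * Q"
| "shift Lc = - Q"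

fun ivl :: "letter \<Rightarrow> int set" where
  "ivl La = {0..<(int n1 + 1) * Q}"
| "ivl Lc = {(int n1 + 1) * Q..<(int n1 + 2) * Q - N}"
| "ivl Lb = {(int n1 + 2) * Q - N..<(2 * int n1 + 2) * Q - N}"

abbreviation coded :: "int \<Rightarrow> letter list \<Rightarrow> bool" where
  "coded \<equiv> itinerary ivl shift"

abbreviation total_shift :: "letter list \<Rightarrow> int" where
  "total_shift u \<equiv> sum_list (map shift u)"

lemma N_Q: "0 < N" "N < Q" "Q = N + int n2 * N + 1"
proof -
  show "0 < N" by (simp add: N_def)
  then have "0 \<le> int n2 * N" by simp
  then show "N < Q" "Q = N + int n2 * N + 1" by (simp_all add: Q_def algebra_simps)
qed

lemma total_shift_power: "total_shift (u \<up> k) = int k * total_shift u"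
  by (induction k) (simp_all add: algebra_simps)

text \<open>
  Reading \<open>cpal\<close> moves a point by \<open>- N\<close>, but reading \<open>A\<close> moves it only by 1: this is what
  makes long powers of \<open>A\<close> codings of orbits.
\<close>
lemma total_shifts:
  "total_shift (pal n1) = Q - N" "total_shift cpal = - N" "total_shift blockA = 1"
proof -
  show p: "total_shift (pal n1) = Q - N"
    by (simp add: pal_def total_shift_power algebra_simps)
  then show c: "total_shift cpal = - N" by (simp add: cpal_def)
  show "total_shift blockA = 1" using N_Q(3) by (simp add: blockA_def total_shift_power p c)
qed

lemma coded_pal:
  assumes "int n1 * Q \<le> x" "x < (int n1 + 1) * Q"
  shows "coded x (pal n1)"
proof -
  have "coded x (pal m)" if "int m * Q \<le> x" "x < (int n1 + 1) * Q" for m x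
    using that
  proof (induction m arbitrary: x)
    case 0
    then show ?case by (simp add: pal_def)
  next
    case (Suc m)
    have "0 \<le> int m * Q" using N_Q by simp
    with Suc.prems have "Q \<le> x" by (simp add: algebra_simps)
    then have "coded x [La, Lb]" "x + total_shift [La, Lb] = x - Q"
      using Suc.prems N_Q(1,2) by (simp_all add: algebra_simps)
    moreover have "coded (x - Q) (pal m)"
      by (rule Suc.IH; use Suc.prems N_Q(1,2) in \<open>simp only: of_nat_Suc algebra_simps; linarith\<close>)
    ultimately show ?case unfolding pal_Suc(1) itinerary_append by simp
  qed
  then show ?thesis using assms by blast
qed

lemma coded_cpal_power:
  assumes "(int n1 + 1) * Q + (int m - 1) * N \<le> x" "x < (int n1 + 2) * Q - N"
  shows "coded x (cpal \<up> m)"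
  using assms
proof (induction m arbitrary: x)
  case (Suc m)
  have m: "0 \<le> int m * N" using N_Q by simp
  have "coded (x - Q) (pal n1)"
    by (rule coded_pal; use Suc.prems m N_Q(1,2) in \<open>simp only: of_nat_Suc algebra_simps; linarith\<close>)
  then have "coded x cpal" using Suc.prems m by (simp add: cpal_def algebra_simps)
  moreover have "coded (x - N) (cpal \<up> m)"
    by (rule Suc.IH; use Suc.prems N_Q(1,2) in \<open>simp only: of_nat_Suc algebra_simps; linarith\<close>)
  ultimately show ?case by (simp add: itinerary_append total_shifts)
qed simp

lemma coded_blockA_power:
  assumes "int n1 * Q + int n2 * N \<le> x" "x + int m \<le> (int n1 + 1) * Q"
  shows "coded x (blockA \<up> m)"
  using assms
proof (induction m arbitrary: x)
  case (Suc m)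
  have "0 \<le> int n2 * N" using N_Q by simp
  then have "coded x (pal n1)" by (intro coded_pal) (use Suc.prems in simp_all)
  moreover have "coded (x + (Q - N)) (cpal \<up> n2)"
    by (rule coded_cpal_power) (use Suc.prems in \<open>simp_all add: algebra_simps\<close>)
  ultimately have "coded x blockA" by (simp add: blockA_def itinerary_append total_shifts)
  moreover have "coded (x + 1) (blockA \<up> m)" by (rule Suc.IH) (use Suc.prems in simp_all)
  ultimately show ?case by (simp add: itinerary_append total_shifts)
qed simp

text \<open>
  The starting point is chosen so that the first \<open>n3 + 1\<close> blocks \<open>A\<close> lead to the left end \<open>(n1
  + 1) Q\<close> of the interval of \<open>c\<close>. There \<open>cpal\<close> can be read, and the last \<open>n3\<close> blocks \<open>A\<close> lead
  back to the start.
\<close>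
lemma coded_vword:
  "coded (int n1 * Q + int n2 * N + int n3 + 1) vword" "total_shift vword = 0"
proof -
  let ?x = "int n1 * Q + int n2 * N + int n3 + 1" and ?y = "(int n1 + 1) * Q"
  have Q: "Q = int n2 * N + 2 * int n3 + 2" using N_Q(3) by (simp add: N_def)
  have "coded ?x (blockA \<up> (n3 + 1))"
    by (rule coded_blockA_power) (simp_all add: algebra_simps Q)
  moreover have "?x + total_shift (blockA \<up> (n3 + 1)) = ?y"
    unfolding total_shift_power total_shifts by (simp add: algebra_simps Q)
  moreover have "coded ?y (cpal \<up> 1)"
    by (rule coded_cpal_power) (use N_Q in \<open>simp_all add: algebra_simps\<close>)
  moreover have "coded (?y - N) (blockA \<up> n3)"
    by (rule coded_blockA_power) (simp_all add: algebra_simps Q N_def)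
  ultimately show "coded ?x vword"
    unfolding vword_def blockC_def itinerary_append by (simp add: total_shifts)
  show "total_shift vword = 0"
    unfolding vword_def blockC_def by (simp add: total_shift_power total_shifts N_def)
qed

lemma letter_less_three: "letter_less [x, y, z] = {(x, y), (x, z), (y, z)}"
proof -
  have "letter_less bs = (\<lambda>(i, j). (bs ! i, bs ! j)) ` {(i, j). i < j \<and> j < length bs}" for bs :: "'a list"
    by (auto simp: letter_less_def)
  moreover have "{(i, j). i < j \<and> j < length [x, y, z]} = {(0, 1), (0, 2), (1, 2)}"
    by auto
  ultimately show ?thesis by (simp add: insert_commute)
qed

text \<open>
  The permutation exchanges \<open>a\<close> and \<open>b\<close> and fixes the middle letter \<open>c\<close>, so \<open>v\<close> is perfectly
  clustering.
\<close>
lemma clustering_vword: "clustering vword"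
proof -
  define \<pi> where "\<pi> l = (case l of La \<Rightarrow> Lb | Lb \<Rightarrow> La | Lc \<Rightarrow> Lc)" for l
  have order: "letter_order [La, Lc, Lb]"
    unfolding letter_order_def by (auto intro: letter.exhaust)
  have invol: "\<pi> (\<pi> l) = l" for l by (cases l) (simp_all add: \<pi>_def)
  have bij: "bij \<pi>" by (rule o_bij[of \<pi>]) (simp_all add: fun_eq_iff invol)
  have "\<pi> \<noteq> id" by (auto simp: \<pi>_def fun_eq_iff intro!: exI[of _ La])
  moreover have "clusters_for [La, Lc, Lb] \<pi> vword"
  proof (rule clusters_for_interval_exchange[OF order bij _ _ coded_vword])
    show "x < y" if "(l, m) \<in> letter_less [La, Lc, Lb]" "x \<in> ivl l" "y \<in> ivl m" for l m x y
      using that N_Q by (auto simp: letter_less_three algebra_simps)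
    show "x + shift l < y + shift m"
      if "(l, m) \<in> letter_less (map \<pi> [La, Lc, Lb])" "x \<in> ivl l" "y \<in> ivl m" for l m x y
      using that N_Q by (auto simp: letter_less_three \<pi>_def algebra_simps)
  qed
  ultimately show ?thesis using order bij by (auto simp: clustering_def)
qed

end

section \<open>The languages of the extremal directive words\<close>

lemma AR_word_decompose:
  assumes "j \<le> k"
  shows "\<exists>ls. AR_word D k l = concat (map (AR_word D j) ls)"
  using assms
proof (induction k arbitrary: l rule: dec_induct)
  case base
  show ?case by (rule exI[of _ "[l]"]) simp
next
  case (step k)
  from step.IH[of l] step.IH[of "D k"] obtain ls ls' where
    "AR_word D k l = concat (map (AR_word D j) ls)"
    "AR_word D k (D k) = concat (map (AR_word D j) ls')" by blast
  then have "AR_word D (Suc k) l = concat (map (AR_word D j) (if l = D k then ls else ls @ ls'))"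
    by (cases "l = D k") simp_all
  then show ?case by blast
qed

lemma AR_word_prefix:
  assumes "j \<le> k"
  shows "prefix (AR_word D j l) (AR_word D k l)"
  using assms by (induction k rule: dec_induct) (auto intro: prefix_order.trans)

locale extremal_directive = extremal_blocks +
  fixes D :: "nat \<Rightarrow> letter"
  assumes directive: "AR_directive D"
    and begins: "begins_with D ([La] @ replicate n1 Lb @ replicate n2 Lc @ replicate n3 La @ [Lb])"
begin

abbreviation \<mu> :: nat where "\<mu> \<equiv> 1 + n1 + n2 + n3"

lemma rules:
  "D 0 = La" "1 \<le> i \<Longrightarrow> i < 1 + n1 \<Longrightarrow> D i = Lb" "1 + n1 \<le> i \<Longrightarrow> i < 1 + n1 + n2 \<Longrightarrow> D i = Lc"
  "1 + n1 + n2 \<le> i \<Longrightarrow> i < \<mu> \<Longrightarrow> D i = La" "D \<mu> = Lb"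
proof -
  note b = begins[unfolded begins_with_blocks]
  show "D 0 = La" "D \<mu> = Lb" using b by auto
  show "D i = Lb" if "1 \<le> i" "i < 1 + n1"
  proof -
    from that have "i = 1 + (i - 1)" "i - 1 < n1" by linarith+
    with b show ?thesis by metis
  qed
  show "D i = Lc" if "1 + n1 \<le> i" "i < 1 + n1 + n2"
  proof -
    from that have "i = 1 + n1 + (i - (1 + n1))" "i - (1 + n1) < n2" by linarith+
    with b show ?thesis by metis
  qed
  show "D i = La" if "1 + n1 + n2 \<le> i" "i < \<mu>"
  proof -
    from that have "i = 1 + n1 + n2 + (i - (1 + n1 + n2))" "i - (1 + n1 + n2) < n3" by linarith+
    with b show ?thesis by metis
  qed
qed

lemma words_at_\<mu>:
  "AR_word D \<mu> La = blockA" "AR_word D \<mu> Lb = blockB" "AR_word D \<mu> Lc = blockC"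
proof -
  have s1: "AR_word D 1 La = [La]" "AR_word D 1 Lb = [Lb, La]" "AR_word D 1 Lc = [Lc, La]"
    using rules(1) by simp_all
  have s2: "AR_word D (1 + n1) La = pal n1" "AR_word D (1 + n1) Lb = [Lb, La]"
    "AR_word D (1 + n1) Lc = cpal"
    using AR_word_run(1)[of 1 n1 D Lb, OF rules(2)] s1 by (simp_all add: pal_def cpal_def)
  have s3: "AR_word D (1 + n1 + n2) La = blockA" "AR_word D (1 + n1 + n2) Lb = [Lb, La] @ cpal \<up> n2"
    "AR_word D (1 + n1 + n2) Lc = cpal"
    using AR_word_run(1)[of "1 + n1" n2 D Lc, OF rules(3)] s2 by (simp_all add: blockA_def)
  show "AR_word D \<mu> La = blockA" "AR_word D \<mu> Lb = blockB" "AR_word D \<mu> Lc = blockC"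
    using AR_word_run(1)[of "1 + n1 + n2" n3 D La, OF rules(4)] s3
    by (simp_all add: blockB_def blockC_def)
qed

lemma parameters:
  "lambda2 D = 1 + n1" "x_letter D = La" "y_letter D = Lb" "mu_y D = \<mu>"
  "last_before D Lb = n1" "mu_string D = 1 + n1 + n2"
proof -
  show l2: "lambda2 D = 1 + n1"
    unfolding lambda2_def
  proof (rule Least_equality)
    show "D (1 + n1) = Lc" using rules(3)[of "1 + n1"] pos by simp
    show "1 + n1 \<le> k" if "D k = Lc" for k
      using that rules(1) rules(2)[of k] by (cases "k = 0"; cases "k < 1 + n1") auto
  qed
  have fa: "first_after D La = 1 + n1 + n2"
    unfolding first_after_def l2
  proof (rule Least_equality)
    show "1 + n1 < 1 + n1 + n2 \<and> D (1 + n1 + n2) = La" using rules(4)[of "1 + n1 + n2"] pos by simp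
    show "1 + n1 + n2 \<le> k" if "1 + n1 < k \<and> D k = La" for k
      using that rules(3)[of k] by (cases "k < 1 + n1 + n2") auto
  qed
  have fb: "first_after D Lb = \<mu>"
    unfolding first_after_def l2
  proof (rule Least_equality)
    show "1 + n1 < \<mu> \<and> D \<mu> = Lb" using rules(5) pos by simp
    show "\<mu> \<le> k" if "1 + n1 < k \<and> D k = Lb" for k
      using that rules(3,4)[of k] by (cases "k < 1 + n1 + n2"; cases "k < \<mu>") auto
  qed
  show "x_letter D = La" and y: "y_letter D = Lb"
    using pos by (simp_all add: x_letter_def y_letter_def fa fb)
  show my: "mu_y D = \<mu>" unfolding mu_y_def y by (rule fb)
  show "last_before D Lb = n1"
    unfolding last_before_def l2
    by (rule Greatest_equality) (use rules(2)[of n1] pos in auto)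
  have last: "D (\<mu> - 1) = La" using rules(4)[of "\<mu> - 1"] pos by simp
  show "mu_string D = 1 + n1 + n2"
    unfolding mu_string_def my last
  proof (rule Least_equality)
    show "1 + n1 + n2 < \<mu> \<and> (\<forall>i. 1 + n1 + n2 \<le> i \<and> i < \<mu> \<longrightarrow> D i = La)"
      using rules(4) pos by simp
    show "1 + n1 + n2 \<le> j" if "j < \<mu> \<and> (\<forall>i. j \<le> i \<and> i < \<mu> \<longrightarrow> D i = La)" for j
    proof (rule ccontr)
      assume "\<not> 1 + n1 + n2 \<le> j"
      then have "D (n1 + n2) = La" using that by simp
      moreover have "D (n1 + n2) = Lc" using rules(3)[of "n1 + n2"] pos by simp
      ultimately show False by simp
    qed
  qed
qed

lemma v_word_eq: "v_word D = vword"
proof -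
  have "words_by_length D \<mu> = [blockA, blockC, blockB]"
    unfolding words_by_length_def words_at_\<mu> using block_length_order by simp
  moreover have "\<mu> - (1 + n1 + n2) + 1 = n3 + 1" by simp
  ultimately show ?thesis
    unfolding v_word_def vword_def S_word_def M_word_def parameters by (simp only:) simp
qed

lemma K_bound_eq: "K_bound D = 2 * n1 + length (blockC @ blockB)"
proof -
  have "length (w_word D n1) = 2 * n1 - 1"
    using AR_word_run(2)[of 1 "n1 - 1" D Lb] rules(1,2) pos by (simp add: length_word_power)
  moreover have "AR_word D (\<mu> + 1) Lc = blockC @ blockB" "AR_word D (\<mu> + 1) La = blockA @ blockB"
    using words_at_\<mu> rules(5) by simp_all
  ultimately show ?thesis
    unfolding K_bound_def parameters using pos block_length_order(1) by simp
qed

text \<open>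
  Every word of the language is a factor of a word of a stage after \<open>\<mu>\<close>, hence of a product of
  \<open>AB\<close>, \<open>B\<close> and \<open>CB\<close>.
\<close>
lemma language_word_not_clustering:
  assumes "u \<in> AR_language D" "length vword < length u"
  shows "\<not> clustering u"
proof -
  from assms(1) obtain k l where u: "sublist u (AR_word D k l)" by (auto simp: AR_language_def)
  define k' where "k' = max k (Suc \<mu>)"
  have "sublist (AR_word D k l) (AR_word D k' l)"
    by (intro prefix_imp_sublist AR_word_prefix) (simp add: k'_def)
  with u have u': "sublist u (AR_word D k' l)" by (rule sublist_order.order.trans)
  have "\<exists>ls. AR_word D k' l = concat (map (AR_word D (Suc \<mu>)) ls)"
    by (rule AR_word_decompose) (simp add: k'_def)
  then obtain ls where ls: "AR_word D k' l = concat (map (AR_word D (Suc \<mu>)) ls)" by blast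
  define f where "f l = (case l of La \<Rightarrow> blockA | Lb \<Rightarrow> [] | Lc \<Rightarrow> blockC)" for l
  have "AR_word D (Suc \<mu>) = (\<lambda>l. f l @ blockB)"
  proof
    show "AR_word D (Suc \<mu>) l = f l @ blockB" for l
      using words_at_\<mu> rules(5) by (cases l) (simp_all add: f_def)
  qed
  with ls have "AR_word D k' l = concat (map (\<lambda>x. x @ blockB) (map f ls))"
    by (simp only: map_map comp_def)
  with u' have "sublist u (concat (map (\<lambda>x. x @ blockB) (map f ls)))" by simp
  then show ?thesis
    by (rule long_factor_not_clustering)
      (use assms(2) length_vword in \<open>auto simp: f_def split: letter.splits\<close>)
qed

text \<open>
  The word \<open>v\<close> is \<open>pal (n1 - 1)\<close> followed by \<open>BC\<close>, and the palindrome is supplied by whatever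
  precedes \<open>B\<close>, as every block ends with \<open>(ba)\<^sup>n\<^sup>1\<close>. A rule \<open>(c)\<close> at a later stage \<open>k\<close>
  concatenates \<open>A\<^sub>k\<close>, which ends with such a \<open>B\<close>, and \<open>C\<^sub>k\<close>, which begins with \<open>C\<close>.
\<close>
lemma vword_in_language: "vword \<in> AR_language D"
proof -
  define s where "s = [Lb, La] \<up> n1"
  have s_suffix: "suffix s v" if "suffix (pal n1) v" for v
    by (rule suffix_order.trans[OF _ that]) (simp add: s_def pal_def suffix_ConsI)
  have after: "AR_word D (Suc \<mu>) l = (if l = Lb then blockB else AR_word D \<mu> l @ blockB)" for l
    using words_at_\<mu> rules(5) by simp
  have ends: "AR_word D k l = blockB \<or> suffix (s @ blockB) (AR_word D k l)" if "Suc \<mu> \<le> k" for k l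
    using that
  proof (induction k arbitrary: l rule: dec_induct)
    case base
    have "suffix (pal n1) (AR_word D \<mu> l)"
      by (cases l) (simp_all only: words_at_\<mu> suffix_pal_blocks)
    then have "suffix (s @ blockB) (AR_word D \<mu> l @ blockB)"
      using s_suffix unfolding suffix_def by force
    then show ?case unfolding after by simp
  next
    case (step k)
    have "suffix s (AR_word D k l)"
      using step.IH[of l] s_suffix[OF suffix_pal_blocks(2)]
      by (metis suffix_appendI suffix_order.trans)
    then show ?case using step.IH[of l] step.IH[of "D k"] by (auto simp: suffix_def)
  qed
  have "infinite {k. D k = Lc}" using directive by (simp add: AR_directive_def)
  then obtain k where k: "\<mu> < k" "D k = Lc"
    by (metis (mono_tags, lifting) finite_nat_set_iff_bounded_le mem_Collect_eq not_le)
  have "prefix (blockA @ blockB) (AR_word D k La)"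
    using AR_word_prefix[of "Suc \<mu>" k D La] k(1) after[of La] words_at_\<mu>(1) by simp
  then have "AR_word D k La \<noteq> blockB" by (auto simp: blockA_def blockB_def pal_def)
  then have "suffix (s @ blockB) (AR_word D k La)" using ends[of k La] k(1) by simp
  moreover have "prefix blockC (AR_word D k Lc)"
    using AR_word_prefix[of \<mu> k D Lc] k(1) words_at_\<mu>(3) by simp
  ultimately have "sublist (s @ blockB @ blockC) (AR_word D (Suc k) La)"
    using k(2) sublist_across[of "s @ blockB"] by simp
  moreover have "sublist vword (s @ blockB @ blockC)"
  proof -
    have "s = [Lb] @ pal (n1 - 1)"
      using pos(1) by (cases n1) (simp_all add: s_def pal_def)
    moreover have "pal (n1 - 1) @ [Lb, La] = pal n1"
      using pos(1) pal_Suc(2)[of "n1 - 1"] by simp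
    ultimately have "s @ blockB @ blockC = [Lb] @ vword @ []"
      by (simp add: blockB_def blockA_def vword_def)
    then show ?thesis by (simp only: sublist_appendI)
  qed
  ultimately show ?thesis
    unfolding AR_language_def by (blast intro: sublist_order.order.trans)
qed

end

theorem corollary16:
  fixes D :: "nat \<Rightarrow> letter"
  assumes "AR_directive D" and "Rabc D"
  shows
    "((\<exists>n1 n2 n3. n1 \<ge> 1 \<and> n2 \<ge> 1 \<and> n3 \<ge> 1 \<and>
        begins_with D ([La] @ replicate n1 Lb @ replicate n2 Lc @ replicate n3 La @ [Lb]))
      \<longrightarrow> v_word D \<in> AR_language D \<and> clustering (v_word D)
        \<and> (\<forall>u \<in> AR_language D. clustering u \<longrightarrow> length u \<le> length (v_word D))
        \<and> length (v_word D) = K_bound D - 1)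
   \<and> (\<not> (\<exists>n1 n2 n3. n1 \<ge> 1 \<and> n2 \<ge> 1 \<and> n3 \<ge> 1 \<and>
        begins_with D ([La] @ replicate n1 Lb @ replicate n2 Lc @ replicate n3 La @ [Lb]))
      \<longrightarrow> length (v_word D) < K_bound D - 1)"
proof (intro conjI impI)
  assume "\<exists>n1 n2 n3. n1 \<ge> 1 \<and> n2 \<ge> 1 \<and> n3 \<ge> 1 \<and>
    begins_with D ([La] @ replicate n1 Lb @ replicate n2 Lc @ replicate n3 La @ [Lb])"
  then obtain n1 n2 n3 where "1 \<le> n1" "1 \<le> n2" "1 \<le> n3"
    "begins_with D ([La] @ replicate n1 Lb @ replicate n2 Lc @ replicate n3 La @ [Lb])" by blast
  then interpret extremal_directive n1 n2 n3 D using assms(1) by unfold_locales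
  show "v_word D \<in> AR_language D" unfolding v_word_eq by (rule vword_in_language)
  show "clustering (v_word D)" unfolding v_word_eq by (rule clustering_vword)
  show "\<forall>u\<in>AR_language D. clustering u \<longrightarrow> length u \<le> length (v_word D)"
    unfolding v_word_eq using language_word_not_clustering by (meson not_le)
  show "length (v_word D) = K_bound D - 1"
    unfolding v_word_eq K_bound_eq using length_vword by linarith
qed (rule v_length_gap[OF assms])

end
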